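(* Let $E$ be a finite-dimensional Euclidean space and let $K\subseteq E$ be a symmetric cone with irreducible decomposition $K=K_1\oplus\cdots\oplus K_m$, $K_i\subseteq E_i$, $E=E_1\oplus\cdots\oplus E_m$. Then the irreducible components $K_i$ are symmetric cones (in $E_i$). Let $F$ be a self-scaled barrier function for $K$. Then there exist self-scaled barrier functions $F_i:\operatorname{ri}(K_i)\to\mathbb{R}$ for the cones $K_i$ ($i=1,\dots,m$) such that $F=F_1\oplus\cdots\oplus F_m$, that is, $$F(x)=\sum_{i=1}^m F_i(x_i)\qquad\text{for all } x=\sum_{i=1}^m x_i\in\operatorname{int}(K),\ x_i\in\operatorname{ri}(K_i).$$ The functions $F_i$ are unique up to additive constants.
   Context: Cones. A cone $K$ in a finite-dimensional Euclidean space $(E,\langle\cdot,\cdot\rangle)$ is regular if it is closed, convex, pointed (contains no line) and solid (non-empty interior). Its dual cone is $K^*=\{s\in E:\langle x,s\rangle\ge 0\ \forall x\in K\}$. $\operatorname{Aut}(K)=\{A\in \mathrm{GL}(E):A(K)=K\}$. A regular cone $K$ is symmetric (homogeneous self-dual) if $\operatorname{Aut}(K)$ acts transitively on $\operatorname{int}(K)$ and $E$ can be endowed with an inner product for which $K^*=K$. $\operatorname{ri}(K_i)$ is the relative interior of $K_i$, i.e. its interior in $E_i$. Decompositions. $K=K_1\oplus\cdots\oplus K_m$ means $E=E_1\oplus\cdots\oplus E_m$ with non-zero subspaces $E_i$, cones $K_i\subseteq E_i$, and $K=K_1+\cdots+K_m$. A cone is irreducible if it admits no such decomposition with $m\ge2$;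 an irreducible decomposition is one in which each $K_i$ is irreducible in $E_i$ ($m=1$ if $K$ itself is irreducible). Self-scaled barriers. Let $K$ be a regular cone. A function $F:\operatorname{int}(K)\to\mathbb{R}$ is a self-concordant barrier if it is $C^3$, convex, $F(x_k)\to\infty$ whenever $x_k\in\operatorname{int}(K)$ converges to a boundary point of $K$, $|D^3F(x)[h,h,h]|\le 2\,(D^2F(x)[h,h])^{3/2}$ for all $x\in\operatorname{int}(K)$, $h\in E$, and $|DF(x)[h]|^2\le\nu\, D^2F(x)[h,h]$ for some constant $\nu$. The Hessian $F''(x)$ is the symmetric operator with $\langle F''(x)u,v\rangle=D^2F(x)[u,v]$. A self-concordant barrier $F$ is self-scaled if $F''(x)$ is non-singular for all $x\in\operatorname{int}(K)$, there is $\nu>0$ with $F(tx)=F(x)-\nu\ln t$ for all $x\in\operatorname{int}(K)$, $t>0$, and for all $x,w\in\operatorname{int}(K)$: $F''(w)x\in\operatorname{int}(K^* )$ and $F_*(F''(w)x)=F(x)-2F(w)-\nu$, where $F_*(s)=\sup\{-\langle x,s\rangle-F(x):x\in\operatorname{int}(K)\}$ for $s\in\operatorname{int}(K^* )$. This notion does not depend on the choice of inner product. For the component $K_i$, all notions are taken in the space $E_i$. *)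

theory Defs
  imports "HOL-Analysis.Analysis"
begin

text \<open>
  The Euclidean spaces in play (the whole space and the summands \<open>E\<^sub>i\<close>) are subspaces \<open>V\<close> of one type
  of class \<^class>\<open>euclidean_space\<close>, with the inner product inherited from it, and each notion takes
  \<open>V\<close> as a parameter. A function on the interior of a cone is a total function
  of which only the values on that interior matter.
\<close>

section \<open>Cones in a subspace\<close>

definition int_in :: "'a::euclidean_space set \<Rightarrow> 'a set \<Rightarrow> 'a set" where
  "int_in V K = top_of_set V interior_of K"

lemma int_in_UNIV: "int_in UNIV K = interior K"
  by (simp add: int_in_def)

definition pointed :: "'a::euclidean_space set \<Rightarrow> bool" where
  "pointed K \<longleftrightarrow> \<not> (\<exists>x d. d \<noteq> 0 \<and> (\<forall>t::real. x + t *\<^sub>R d \<in> K))"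

definition regular_cone :: "'a::euclidean_space set \<Rightarrow> 'a set \<Rightarrow> bool" where
  "regular_cone V K \<longleftrightarrow>
     subspace V \<and> K \<subseteq> V \<and> cone K \<and> closed K \<and> convex K \<and> pointed K \<and> int_in V K \<noteq> {}"

definition inner_product_on :: "'a::euclidean_space set \<Rightarrow> ('a \<Rightarrow> 'a \<Rightarrow> real) \<Rightarrow> bool" where
  "inner_product_on V B \<longleftrightarrow>
     (\<forall>x\<in>V. \<forall>y\<in>V. B x y = B y x) \<and>
     (\<forall>x\<in>V. \<forall>y\<in>V. \<forall>z\<in>V. B (x + y) z = B x z + B y z) \<and>
     (\<forall>x\<in>V. \<forall>y\<in>V. \<forall>c. B (c *\<^sub>R x) y = c * B x y) \<and>
     (\<forall>x\<in>V. x \<noteq> 0 \<longrightarrow> B x x > 0)"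

definition dual_cone :: "'a::euclidean_space set \<Rightarrow> ('a \<Rightarrow> 'a \<Rightarrow> real) \<Rightarrow> 'a set \<Rightarrow> 'a set" where
  "dual_cone V B K = {s \<in> V. \<forall>x\<in>K. B x s \<ge> 0}"

text \<open>An element of \<open>GL(V)\<close> is given by a linear map on the whole type that restricts to a bijection
  of \<open>V\<close>; every linear bijection of \<open>V\<close> is such a restriction.\<close>

definition cone_aut :: "'a::euclidean_space set \<Rightarrow> 'a set \<Rightarrow> ('a \<Rightarrow> 'a) set" where
  "cone_aut V K = {A. linear A \<and> bij_betw A V V \<and> A ` K = K}"

definition symmetric_cone :: "'a::euclidean_space set \<Rightarrow> 'a set \<Rightarrow> bool" where
  "symmetric_cone V K \<longleftrightarrow>
     regular_cone V K \<and>
     (\<forall>x\<in>int_in V K. \<forall>y\<in>int_in V K. \<exists>A\<in>cone_aut V K. A x = y) \<and>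
     (\<exists>B. inner_product_on V B \<and> dual_cone V B K = K)"

section \<open>Decompositions\<close>

text \<open>Sums of sets are Minkowski sums; \<open>set_sum_alt\<close> gives the elementwise description.\<close>

definition direct_sum :: "'a::euclidean_space set \<Rightarrow> nat \<Rightarrow> (nat \<Rightarrow> 'a set) \<Rightarrow> bool" where
  "direct_sum V m E \<longleftrightarrow>
     (\<forall>i\<in>{1..m}. subspace (E i)) \<and> V = (\<Sum>i\<in>{1..m}. E i) \<and>
     (\<forall>x. (\<forall>i\<in>{1..m}. x i \<in> E i) \<and> (\<Sum>i\<in>{1..m}. x i) = 0 \<longrightarrow> (\<forall>i\<in>{1..m}. x i = 0))"

definition cone_decomposition ::
  "'a::euclidean_space set \<Rightarrow> 'a set \<Rightarrow> nat \<Rightarrow> (nat \<Rightarrow> 'a set) \<Rightarrow> (nat \<Rightarrow> 'a set) \<Rightarrow> bool" where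
  "cone_decomposition V K m E Ks \<longleftrightarrow>
     direct_sum V m E \<and> (\<forall>i\<in>{1..m}. E i \<noteq> {0}) \<and>
     (\<forall>i\<in>{1..m}. cone (Ks i) \<and> Ks i \<subseteq> E i) \<and> K = (\<Sum>i\<in>{1..m}. Ks i)"

definition irreducible_cone :: "'a::euclidean_space set \<Rightarrow> 'a set \<Rightarrow> bool" where
  "irreducible_cone V K \<longleftrightarrow> \<not> (\<exists>m E Ks. m \<ge> 2 \<and> cone_decomposition V K m E Ks)"

definition irreducible_decomposition ::
  "'a::euclidean_space set \<Rightarrow> 'a set \<Rightarrow> nat \<Rightarrow> (nat \<Rightarrow> 'a set) \<Rightarrow> (nat \<Rightarrow> 'a set) \<Rightarrow> bool" where
  "irreducible_decomposition V K m E Ks \<longleftrightarrow>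
     cone_decomposition V K m E Ks \<and> (\<forall>i\<in>{1..m}. irreducible_cone (E i) (Ks i))"

section \<open>Derivatives on a relatively open set\<close>

text \<open>
  In the following, \<open>U\<close> is relatively open in the subspace \<open>V\<close>. The derivative within \<open>U\<close>
  is then unique on \<open>V\<close>, and it is only applied to directions in \<open>V\<close>; its values elsewhere
  are arbitrary unless \<open>V\<close> is the whole space. Higher derivatives are formed
  with the earlier directions held fixed, and \<open>C\<^sup>k\<close> is required direction by direction,
  which in finite dimension is the same as \<open>C\<^sup>k\<close> in operator norm.
\<close>

definition D1 :: "'a::euclidean_space set \<Rightarrow> ('a \<Rightarrow> real) \<Rightarrow> 'a \<Rightarrow> 'a \<Rightarrow> real" where
  "D1 U f x h = frechet_derivative f (at x within U) h"

definition D2 :: "'a::euclidean_space set \<Rightarrow> ('a \<Rightarrow> real) \<Rightarrow> 'a \<Rightarrow> 'a \<Rightarrow> 'a \<Rightarrow> real" where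
  "D2 U f x h k = D1 U (\<lambda>y. D1 U f y h) x k"

definition D3 :: "'a::euclidean_space set \<Rightarrow> ('a \<Rightarrow> real) \<Rightarrow> 'a \<Rightarrow> 'a \<Rightarrow> 'a \<Rightarrow> 'a \<Rightarrow> real" where
  "D3 U f x h k l = D1 U (\<lambda>y. D2 U f y h k) x l"

primrec Ck_on :: "nat \<Rightarrow> 'a::euclidean_space set \<Rightarrow> 'a set \<Rightarrow> ('a \<Rightarrow> real) \<Rightarrow> bool" where
  "Ck_on 0 V U f \<longleftrightarrow> continuous_on U f"
| "Ck_on (Suc k) V U f \<longleftrightarrow> f differentiable_on U \<and> (\<forall>h\<in>V. Ck_on k V U (\<lambda>x. D1 U f x h))"

definition hessian :: "'a::euclidean_space set \<Rightarrow> 'a set \<Rightarrow> ('a \<Rightarrow> real) \<Rightarrow> 'a \<Rightarrow> 'a \<Rightarrow> 'a" where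
  "hessian V U f x u = (THE w. w \<in> V \<and> (\<forall>v\<in>V. w \<bullet> v = D2 U f x u v))"

section \<open>Self-scaled barriers\<close>

definition self_concordant_barrier ::
  "'a::euclidean_space set \<Rightarrow> 'a set \<Rightarrow> ('a \<Rightarrow> real) \<Rightarrow> bool" where
  "self_concordant_barrier V K F \<longleftrightarrow>
    (let U = int_in V K in
       Ck_on 3 V U F \<and> convex_on U F \<and>
       (\<forall>X p. (\<forall>n. X n \<in> U) \<and> X \<longlonglongrightarrow> p \<and> p \<in> top_of_set V frontier_of K
          \<longrightarrow> filterlim (\<lambda>n. F (X n)) at_top sequentially) \<and>
       (\<forall>x\<in>U. \<forall>h\<in>V. \<bar>D3 U F x h h h\<bar> \<le> 2 * D2 U F x h h powr (3/2)) \<and>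
       (\<exists>\<nu>. \<forall>x\<in>U. \<forall>h\<in>V. \<bar>D1 U F x h\<bar>\<^sup>2 \<le> \<nu> * D2 U F x h h))"

text \<open>Extended reals, because a real supremum would have an unspecified value
  on unbounded sets.\<close>

definition conjugate_barrier ::
  "'a::euclidean_space set \<Rightarrow> 'a set \<Rightarrow> ('a \<Rightarrow> real) \<Rightarrow> 'a \<Rightarrow> ereal" where
  "conjugate_barrier V K F s = (SUP x\<in>int_in V K. ereal (- (x \<bullet> s) - F x))"

definition self_scaled_barrier ::
  "'a::euclidean_space set \<Rightarrow> 'a set \<Rightarrow> ('a \<Rightarrow> real) \<Rightarrow> bool" where
  "self_scaled_barrier V K F \<longleftrightarrow>
    (let U = int_in V K in
       self_concordant_barrier V K F \<and>
       (\<forall>x\<in>U. bij_betw (hessian V U F x) V V) \<and>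
       (\<exists>\<nu>>0. (\<forall>x\<in>U. \<forall>t>0. F (t *\<^sub>R x) = F x - \<nu> * ln t) \<and>
          (\<forall>x\<in>U. \<forall>w\<in>U.
             hessian V U F w x \<in> int_in V (dual_cone V (\<bullet>) K) \<and>
             conjugate_barrier V K F (hessian V U F w x) = ereal (F x - 2 * F w - \<nu>))))"

text \<open>\<open>F = F\<^sub>1 \<oplus> \<dots> \<oplus> F\<^sub>m\<close> with each \<open>F\<^sub>i\<close> a self-scaled barrier for \<open>K\<^sub>i\<close> in \<open>E\<^sub>i\<close>.\<close>

definition barrier_decomposition ::
  "'a::euclidean_space set \<Rightarrow> 'a set \<Rightarrow> nat \<Rightarrow> (nat \<Rightarrow> 'a set) \<Rightarrow> (nat \<Rightarrow> 'a set) \<Rightarrow>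
   ('a \<Rightarrow> real) \<Rightarrow> (nat \<Rightarrow> 'a \<Rightarrow> real) \<Rightarrow> bool" where
  "barrier_decomposition V K m E Ks F Fs \<longleftrightarrow>
     (\<forall>i\<in>{1..m}. self_scaled_barrier (E i) (Ks i) (Fs i)) \<and>
     (\<forall>x. (\<forall>i\<in>{1..m}. x i \<in> int_in (E i) (Ks i)) \<and> (\<Sum>i\<in>{1..m}. x i) \<in> int_in V K
        \<longrightarrow> F (\<Sum>i\<in>{1..m}. x i) = (\<Sum>i\<in>{1..m}. Fs i (x i)))"

end

theory Submission
  imports Defs
begin

text \<open>
  Everything rests on one observation about self-dual cones. Let \<open>b\<close> be a bilinear form for which \<open>K\<close>
  is self-dual, i.e. \<open>h \<in> K\<close> iff \<open>b h k \<ge> 0\<close> for all \<open>k \<in> K\<close>, and let \<open>b k k \<noteq> 0\<close> for non-zero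
  \<open>k \<in> K\<close>. Then the parts of any direct decomposition of \<open>K\<close> are \<open>b\<close>-orthogonal
  (\<open>splits_orthogonal\<close>). This is used twice: for an inner product that makes \<open>K\<close> self-dual, and for
  the second derivative \<open>D\<^sup>2F(w)\<close> of a self-scaled barrier at an interior point \<open>w\<close>.

  Applied to the inner product, it makes the components self-dual (\<open>self_dual_block\<close>). Homogeneity
  comes from irreducibility: an automorphism of \<open>K\<close> permutes the irreducible components
  (\<open>cone_aut_permutes\<close>). To move \<open>x\<close> to \<open>y\<close> inside one component, fix the coordinates of some
  interior point \<open>e\<close> in the other components and take an automorphism \<open>A\<close> that moves the point completed
  from \<open>x\<close> to the point completed from \<open>y\<close>. If the component returns to itself after \<open>n\<close>
  steps, then \<open>A\<close> pushes \<open>x\<close> through coordinates of \<open>e\<close> and \<open>A\<^sup>n x = y\<close>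
  (\<open>homogeneous_block\<close>).

  For the barrier one first shows that \<open>K\<close> is self-dual under \<open>D\<^sup>2F(w)\<close> (\<open>H_dual\<close>).
  By scaled duality \<open>F''(w)\<close> maps \<open>K\<close> into \<open>K\<^sup>*\<close>. Conversely, if \<open>F''(w) h \<in> K\<^sup>*\<close> but
  \<open>h \<notin> K\<close>, the segment from \<open>w\<close> to \<open>h\<close> leaves \<open>K\<close> at a boundary point; along the segment \<open>F\<close>
  stays bounded above, because \<open>F\<^sub>*\<close> decreases in the order of \<open>K\<^sup>*\<close> and
  \<open>F\<close> is \<open>F\<^sub>* \<circ> F''(w)\<close> up to a constant, which contradicts the blow-up of \<open>F\<close> at the boundary.
  The barrier inequality and logarithmic homogeneity give \<open>D\<^sup>2F(w)[k, k] \<noteq> 0\<close> (\<open>H_definite\<close>).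
  Hence the mixed second derivatives of \<open>F\<close> across components vanish everywhere, so \<open>F\<close> is
  a sum of functions of the components (\<open>F_exchange\<close>, \<open>F_sum_blocks\<close>). The \<open>i\<close>th summand is
  \<open>F\<close> with the other coordinates frozen, after rescaling the frozen point to a zero of \<open>F\<close>.

  That a frozen function is again a self-scaled barrier (\<open>self_scaled_block\<close>) is clear for the
  differential inequalities. For the conjugate, the supremum that
  defines \<open>F\<^sub>*\<close> separates into one supremum for the component and one for its complement. Each has an
  upper bound of the required form, and the two bounds add up to the known value of the whole, so both are
  equalities (\<open>partial_conjugate\<close>).
\<close>

(* keeps {1..m} from being rewritten to {Suc 0..m} *)
declare One_nat_def [simp del]

section \<open>Relative interiors\<close>

lemma int_in_iff:
  assumes "subspace V" "K \<subseteq> V"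
  shows "x \<in> int_in V K \<longleftrightarrow> x \<in> V \<and> (\<exists>\<epsilon>>0. \<forall>y\<in>V. dist y x < \<epsilon> \<longrightarrow> y \<in> K)"
proof
  assume "x \<in> int_in V K"
  then obtain T where T: "openin (top_of_set V) T" "x \<in> T" "T \<subseteq> K"
    by (auto simp: int_in_def interior_of_def)
  then show "x \<in> V \<and> (\<exists>\<epsilon>>0. \<forall>y\<in>V. dist y x < \<epsilon> \<longrightarrow> y \<in> K)"
    unfolding openin_euclidean_subtopology_iff by blast
next
  assume R: "x \<in> V \<and> (\<exists>\<epsilon>>0. \<forall>y\<in>V. dist y x < \<epsilon> \<longrightarrow> y \<in> K)"
  then obtain \<epsilon> where e: "\<epsilon> > 0" "\<forall>y\<in>V. dist y x < \<epsilon> \<longrightarrow> y \<in> K" by blast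
  have "openin (top_of_set V) (V \<inter> ball x \<epsilon>)" by (simp add: openin_open_Int)
  moreover have "x \<in> V \<inter> ball x \<epsilon>" using R e by simp
  moreover have "V \<inter> ball x \<epsilon> \<subseteq> K" using e by (auto simp: dist_commute)
  ultimately show "x \<in> int_in V K" unfolding int_in_def interior_of_def by blast
qed

lemma openin_int_in: "openin (top_of_set V) (int_in V K)"
  by (simp add: int_in_def)

section \<open>Derivatives along a subspace\<close>

lemma D1_works:
  assumes "f differentiable (at x within U)"
  shows "(f has_derivative D1 U f x) (at x within U)"
proof -
  have "D1 U f x = frechet_derivative f (at x within U)" by (simp add: D1_def fun_eq_iff)
  then show ?thesis using assms frechet_derivative_works by metis
qed

text \<open>
  A relatively open subset of \<open>V\<close> may be nowhere dense in the whole space, where Frechet derivatives are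
  not unique. In directions of \<open>V\<close> they are, because \<open>U\<close> contains a short segment in each of these
  directions and the derivative along the segment is an ordinary one.
\<close>
lemma D1_eq:
  fixes f :: "'a::euclidean_space \<Rightarrow> real"
  assumes "subspace V" "openin (top_of_set V) U" "x \<in> U"
    and "(f has_derivative f') (at x within U)" and "h \<in> V"
  shows "D1 U f x h = f' h"
proof -
  have U: "U \<subseteq> V" using assms(2) openin_imp_subset by blast
  let ?S = "{t::real. x + t *\<^sub>R h \<in> U}"
  have lV: "x + t *\<^sub>R h \<in> V" for t
    using assms U by (meson subsetD subspace_add subspace_scale)
  obtain O' where O: "open O'" "U = V \<inter> O'" using assms(2) openin_open by metis
  have S: "?S = (\<lambda>t. x + t *\<^sub>R h) -` O'" using O lV by auto
  have oS: "open ?S" unfolding S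
    by (rule open_vimage[OF O(1)]) (intro continuous_intros)
  have "f differentiable (at x within U)" using assms(4) by (auto simp: differentiable_def)
  then have g: "(f has_derivative D1 U f x) (at x within U)"
    by (rule D1_works)
  have *: "((\<lambda>t. f (x + t *\<^sub>R h)) has_derivative (\<lambda>t. g (t *\<^sub>R h))) (at 0)"
    if "(f has_derivative g) (at x within U)" for g
  proof -
    have "((\<lambda>t. x + t *\<^sub>R h) has_derivative (\<lambda>t. t *\<^sub>R h)) (at 0 within ?S)"
      by (auto intro!: derivative_eq_intros)
    moreover have "(f has_derivative g) (at (x + 0 *\<^sub>R h) within ((\<lambda>t. x + t *\<^sub>R h) ` ?S))"
      using that by (auto intro: has_derivative_subset)
    ultimately have "((\<lambda>t. f (x + t *\<^sub>R h)) has_derivative (\<lambda>t. g (t *\<^sub>R h))) (at 0 within ?S)"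
      by (rule has_derivative_in_compose)
    then show ?thesis using at_within_open[OF _ oS, of 0] assms(3) by simp
  qed
  show ?thesis
    using fun_cong[OF has_derivative_unique[OF *[OF g] *[OF assms(4)]], of 1] by simp
qed

lemma D1_cong:
  assumes "x \<in> U" "\<And>y. y \<in> U \<Longrightarrow> f y = g y"
  shows "D1 U f x = D1 U g x"
proof -
  have "(f has_derivative d) (at x within U) \<longleftrightarrow> (g has_derivative d) (at x within U)" for d
    using has_derivative_transform[OF assms(1), of f g d]
      has_derivative_transform[OF assms(1), of g f d] assms(2) by auto
  then show ?thesis by (simp add: D1_def frechet_derivative_def fun_eq_iff)
qed

lemma Ck_on_cong:
  assumes "\<And>y. y \<in> U \<Longrightarrow> f y = g y"
  shows "Ck_on n V U f \<Longrightarrow> Ck_on n V U g"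
  using assms
proof (induction n arbitrary: f g)
  case 0
  then show ?case using continuous_on_cong[of U U f g] by simp
next
  case (Suc n)
  have "g differentiable_on U"
  proof -
    have "f differentiable_on U" using Suc.prems by simp
    then show ?thesis
      unfolding differentiable_on_def differentiable_def
      using has_derivative_transform[of _ U g f] Suc.prems(2) by metis
  qed
  moreover have "Ck_on n V U (\<lambda>x. D1 U g x h)" if "h \<in> V" for h
    using Suc.IH[of "\<lambda>x. D1 U f x h" "\<lambda>x. D1 U g x h"] Suc.prems that D1_cong[of _ U f g] by auto
  ultimately show ?case by simp
qed

lemma D1_has_derivative:
  assumes "open W" "x \<in> W" "F differentiable_on W"
  shows "(F has_derivative D1 W F x) (at x)"
proof -
  have "F differentiable (at x within W)" using assms by (simp add: differentiable_on_def)
  then show ?thesis using D1_works assms(1,2) at_within_open by metis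
qed

lemma has_derivative_translate:
  assumes "(F has_derivative F') (at (x + a))"
  shows "((\<lambda>y. F (y + a)) has_derivative F') (at x within U)"
proof -
  have "((\<lambda>y. y + a) has_derivative (\<lambda>h. h)) (at x within U)"
    by (auto intro!: derivative_eq_intros)
  from has_derivative_compose[OF this assms] show ?thesis .
qed

lemma D1_translate:
  assumes "subspace V" "openin (top_of_set V) U" "x \<in> U" "h \<in> V"
    and "open W" "x + a \<in> W" "F differentiable_on W"
  shows "D1 U (\<lambda>y. F (y + a)) x h = D1 W F (x + a) h"
  by (rule D1_eq[OF assms(1-3) has_derivative_translate[OF D1_has_derivative[OF assms(5-7)]] assms(4)])

text \<open>
  This and the next lemma carry regularity and derivatives from \<open>F\<close> on an open set to the restriction
  of \<open>F\<close> to a slice \<open>V + a\<close>, reparametrised by \<open>V\<close>.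
\<close>
lemma Ck_on_translate:
  assumes "subspace V" "openin (top_of_set V) U" "open W" "\<And>y. y \<in> U \<Longrightarrow> y + a \<in> W"
  shows "Ck_on n UNIV W F \<Longrightarrow> Ck_on n V U (\<lambda>y. F (y + a))"
proof (induction n arbitrary: F)
  case 0
  have "continuous_on U (\<lambda>y. y + a)" by (intro continuous_intros)
  then show ?case using 0 assms(4) by (auto intro: continuous_on_compose2)
next
  case (Suc n)
  then have d: "F differentiable_on W" by simp
  have "(\<lambda>y. F (y + a)) differentiable_on U"
    unfolding differentiable_on_def
    using has_derivative_translate[OF D1_has_derivative[OF assms(3) assms(4) d]]
    by (meson differentiableI)
  moreover have "Ck_on n V U (\<lambda>x. D1 U (\<lambda>y. F (y + a)) x h)" if "h \<in> V" for h
  proof (rule Ck_on_cong)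
    show "Ck_on n V U (\<lambda>y. D1 W F (y + a) h)"
      using Suc.IH[of "\<lambda>x. D1 W F x h"] Suc.prems by simp
    show "D1 W F (y + a) h = D1 U (\<lambda>y. F (y + a)) y h" if "y \<in> U" for y
      using D1_translate[OF assms(1,2) that \<open>h \<in> V\<close> assms(3) assms(4)[OF that] d] by (rule sym)
  qed
  ultimately show ?case by simp
qed

lemma D2_D3_translate:
  assumes V: "subspace V" "openin (top_of_set V) U" "open W" "\<And>y. y \<in> U \<Longrightarrow> y + a \<in> W"
    and F: "Ck_on 3 UNIV W F" and x: "x \<in> U" and hV: "h \<in> V" "k \<in> V" "l \<in> V"
  shows "D2 U (\<lambda>y. F (y + a)) x h k = D2 W F (x + a) h k"
    and "D3 U (\<lambda>y. F (y + a)) x h k l = D3 W F (x + a) h k l"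
proof -
  let ?f = "\<lambda>y. F (y + a)"
  have F0: "F differentiable_on W"
    and F1: "(\<lambda>y. D1 W F y h) differentiable_on W"
    and F2: "(\<lambda>y. D2 W F y h k) differentiable_on W"
    using F hV unfolding numeral_3_eq_3 D2_def by simp_all
  have 1: "D1 U ?f y h = D1 W F (y + a) h" if "y \<in> U" for y
    by (rule D1_translate[OF V(1,2) that hV(1) V(3) V(4)[OF that] F0])
  have 2: "D2 U ?f y h k = D2 W F (y + a) h k" if "y \<in> U" for y
  proof -
    have "D2 U ?f y h k = D1 U (\<lambda>y. D1 W F (y + a) h) y k"
      unfolding D2_def
      by (rule fun_cong[OF D1_cong[OF that, where f = "\<lambda>y. D1 U ?f y h", OF 1]])
    also have "\<dots> = D1 W (\<lambda>y. D1 W F y h) (y + a) k"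
      by (rule D1_translate[OF V(1,2) that hV(2) V(3) V(4)[OF that] F1])
    finally show ?thesis by (simp only: D2_def)
  qed
  show "D2 U ?f x h k = D2 W F (x + a) h k" by (rule 2[OF x])
  have "D3 U ?f x h k l = D1 U (\<lambda>y. D2 W F (y + a) h k) x l"
    unfolding D3_def
    by (rule fun_cong[OF D1_cong[OF x, where f = "\<lambda>y. D2 U ?f y h k", OF 2]])
  also have "\<dots> = D1 W (\<lambda>y. D2 W F y h k) (x + a) l"
    by (rule D1_translate[OF V(1,2) x hV(3) V(3) V(4)[OF x] F2])
  finally show "D3 U ?f x h k l = D3 W F (x + a) h k l" by (simp only: D3_def)
qed


section \<open>Direct decompositions of a cone\<close>

text \<open>
  A decomposition of \<open>K\<close> into two parts is encoded by the projection onto one of them along the other; the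
  parts are \<open>P ` K\<close> and \<open>(\<lambda>x. x - P x) ` K\<close>. Statements for one part then also give those for the
  other.
\<close>
definition splits :: "('a::euclidean_space \<Rightarrow> 'a) \<Rightarrow> 'a set \<Rightarrow> bool" where
  "splits P K \<longleftrightarrow> linear P \<and> (\<forall>x. P (P x) = P x) \<and> (\<forall>x\<in>K. P x \<in> K \<and> x - P x \<in> K)"

lemma splits_compl: "splits P K \<Longrightarrow> splits (\<lambda>x. x - P x) K"
  unfolding splits_def by (auto intro: linear_compose_sub linear_ident simp: linear_diff)

lemma convex_cone_add:
  assumes "convex K" "cone K" "x \<in> K" "y \<in> K"
  shows "x + y \<in> K"
  using assms convex_cone by blast

lemma pointed_no_line:
  assumes "cone K" "pointed K" "x \<in> K" "- x \<in> K"
  shows "x = 0"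
proof (rule ccontr)
  assume "x \<noteq> 0"
  have "0 + t *\<^sub>R x \<in> K" for t
  proof (cases "t \<ge> 0")
    case True
    then show ?thesis using assms by (simp add: cone_def)
  next
    case False
    then have "(- t) *\<^sub>R (- x) \<in> K" using assms(1,4) unfolding cone_def by (meson linear neg_0_le_iff_le)
    then show ?thesis by simp
  qed
  then show False using assms(2) \<open>x \<noteq> 0\<close> unfolding pointed_def by blast
qed

text \<open>
  The part of \<open>K\<close> in the kernel of \<open>P\<close> is a face: the images \<open>P x\<close> and \<open>P y\<close> lie in
  \<open>K\<close> and are opposite, and \<open>K\<close> contains no line.
\<close>
lemma splits_face:
  assumes "cone K" "pointed K" "splits P K" "x \<in> K" "y \<in> K" "P (x + y) = 0"
  shows "P x = 0" "P y = 0"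
proof -
  have "P x \<in> K" "P y \<in> K" "P x + P y = 0"
    using assms by (auto simp: splits_def linear_add)
  then show "P x = 0" using pointed_no_line[OF assms(1,2)]
    by (metis add_eq_0_iff)
  then show "P y = 0" using \<open>P x + P y = 0\<close> by simp
qed

lemma splits_image: "splits P K \<Longrightarrow> P ` K = K \<inter> range P"
  unfolding splits_def by (auto simp: image_iff) metis

text \<open>
  The interior is a product: a point near \<open>P x + (y - P y)\<close> has the first coordinate of a point near \<open>x\<close> and
  the second coordinate of a point near \<open>y\<close>.
\<close>
lemma interior_exchange:
  assumes K: "convex K" "cone K" and P: "splits P K" and x: "x \<in> interior K" and y: "y \<in> interior K"
  shows "P x + (y - P y) \<in> interior K"
proof -
  have lP: "linear P" and idem: "P (P z) = P z" for z using P by (auto simp: splits_def)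
  note cP = linear_continuous_on[OF lP[unfolded linear_conv_bounded_linear]]
  let ?z = "P x + (y - P y)"
  let ?g = "\<lambda>z. x + P (z - ?z)" and ?h = "\<lambda>z. y + ((z - ?z) - P (z - ?z))"
  have c: "continuous_on UNIV (\<lambda>z. P (z - ?z))"
    by (rule continuous_on_compose2[OF cP[of UNIV]]) (auto intro!: continuous_intros)
  let ?W = "?g -` interior K \<inter> ?h -` interior K"
  have "open ?W"
    by (intro open_Int continuous_on_open_vimage[THEN iffD1, rule_format] open_vimage)
      (auto intro!: continuous_intros c)
  moreover have "?z \<in> ?W" using x y lP by (simp add: linear_0)
  moreover have "?W \<subseteq> K"
  proof
    fix z assume "z \<in> ?W"
    then have "?g z \<in> K" "?h z \<in> K" using interior_subset by auto
    then have "P (?g z) \<in> K" "?h z - P (?h z) \<in> K" using P by (auto simp: splits_def)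
    then have mem: "P (?g z) + (?h z - P (?h z)) \<in> K" by (rule convex_cone_add[OF K])
    have eq: "P (?g z) + (?h z - P (?h z)) = z"
      using lP by (simp add: linear_add linear_diff idem algebra_simps)
    show "z \<in> K" using mem unfolding eq .
  qed
  ultimately show ?thesis by (meson interiorI)
qed

lemma int_in_range:
  assumes K: "convex K" "cone K" "interior K \<noteq> {}" and P: "splits P K"
  shows "int_in (range P) (P ` K) = P ` interior K"
proof -
  have lP: "linear P" and idem: "P (P z) = P z" for z using P by (auto simp: splits_def)
  have sub: "subspace (range P)" using lP by (simp add: linear_subspace_image)
  have iff: "x \<in> int_in (range P) (P ` K) \<longleftrightarrow>
      x \<in> range P \<and> (\<exists>\<epsilon>>0. \<forall>y\<in>range P. dist y x < \<epsilon> \<longrightarrow> y \<in> P ` K)" for x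
    by (rule int_in_iff[OF sub]) auto
  have cP: "continuous_on UNIV P"
    by (rule linear_continuous_on[OF lP[unfolded linear_conv_bounded_linear]])
  show ?thesis
  proof (intro set_eqI iffI)
    fix p assume p: "p \<in> int_in (range P) (P ` K)"
    then obtain \<epsilon> where e: "\<epsilon> > 0" "\<And>y. y \<in> range P \<Longrightarrow> dist y p < \<epsilon> \<Longrightarrow> y \<in> P ` K"
      and "p \<in> range P"
      unfolding iff by blast
    then have Pp: "P p = p" using idem by auto
    obtain u where u: "u \<in> interior K" using K(3) by blast
    let ?z = "p + (u - P u)"
    let ?h = "\<lambda>z. u + ((z - ?z) - P (z - ?z))"
    have c: "continuous_on UNIV (\<lambda>z. P (z - ?z))"
      by (rule continuous_on_compose2[OF cP]) (auto intro!: continuous_intros)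
    let ?W = "P -` ball p \<epsilon> \<inter> ?h -` interior K"
    have "open ?W"
      by (intro open_Int open_vimage) (auto intro!: continuous_intros c cP)
    moreover have "?z \<in> ?W" using u lP e(1) Pp by (simp add: linear_0 linear_add linear_diff idem)
    moreover have "?W \<subseteq> K"
    proof
      fix z assume z: "z \<in> ?W"
      then have "P z \<in> P ` K" using e(2)[of "P z"] by (simp add: dist_commute)
      then have 1: "P z \<in> K" using P by (auto simp: splits_def)
      have "?h z \<in> K" using z interior_subset by auto
      then have "?h z - P (?h z) \<in> K" using P by (auto simp: splits_def)
      moreover have "?h z - P (?h z) = z - P z"
        using lP Pp by (simp add: linear_add linear_diff idem algebra_simps)
      ultimately have "P z + (z - P z) \<in> K" using convex_cone_add[OF K(1,2) 1] by metis
      then show "z \<in> K" by simp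
    qed
    ultimately have "?z \<in> interior K" by (meson interiorI)
    moreover have "P ?z = p" using lP Pp by (simp add: linear_add linear_diff idem)
    ultimately show "p \<in> P ` interior K" by (metis imageI)
  next
    fix p assume "p \<in> P ` interior K"
    then obtain x where x: "x \<in> interior K" "p = P x" by blast
    then obtain \<epsilon> where e: "\<epsilon> > 0" "ball x \<epsilon> \<subseteq> K" using mem_interior by blast
    have "y \<in> P ` K" if "y \<in> range P" "dist y p < \<epsilon>" for y
    proof -
      have "x + (y - P x) \<in> K"
        using e(2) that(2) x(2) by (auto simp: subset_eq dist_norm norm_minus_commute)
      moreover have "P (x + (y - P x)) = y"
        using that(1) lP by (auto simp: linear_add linear_diff idem)
      ultimately show ?thesis by (metis imageI)
    qed
    then show "p \<in> int_in (range P) (P ` K)" using iff e(1) x(2) by blast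
  qed
qed

section \<open>Self-duality under a bilinear form\<close>

lemma linear_functional_inner:
  fixes g :: "'a::euclidean_space \<Rightarrow> real"
  assumes "linear g"
  shows "g k = adjoint g 1 \<bullet> k"
  using adjoint_works[OF assms, of k 1] by (simp add: inner_commute)

text \<open>
  Since \<open>K\<close> is pointed, \<open>b\<close> is non-degenerate, so for \<open>x \<in> K\<close> the functional \<open>k \<mapsto> b (P x) (P k)\<close> is
  \<open>b y\<close> for some \<open>y\<close>. By self-duality both \<open>y\<close> and the remainder \<open>z = P x - y\<close>
  lie in \<open>K\<close>, and they sum to a point of the face \<open>P ` K\<close>, so \<open>P z = z\<close>. But
  \<open>b z\<close> only sees the complementary coordinate, hence \<open>b z z = 0\<close> and \<open>z = 0\<close>.
\<close>
lemma splits_orthogonal: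
  fixes K :: "'a::euclidean_space set" and b :: "'a \<Rightarrow> 'a \<Rightarrow> real"
  assumes K: "convex K" "cone K" "pointed K" "interior K \<noteq> {}"
    and P: "splits P K"
    and b: "bilinear b"
    and dual: "\<And>h. h \<in> K \<longleftrightarrow> (\<forall>k\<in>K. b h k \<ge> 0)"
    and pos: "\<And>k. k \<in> K \<Longrightarrow> k \<noteq> 0 \<Longrightarrow> b k k \<noteq> 0"
  shows "b (P h) (k - P k) = 0"
proof -
  have lP: "linear P" and idem: "P (P z) = P z" for z using P by (auto simp: splits_def)
  have lr: "linear (b h)" and ll: "linear (\<lambda>h. b h k)" for h k using b by (auto simp: bilinear_def)
  have PK: "P x \<in> K" "x - P x \<in> K" if "x \<in> K" for x using P that by (auto simp: splits_def)
  define T where "T h = adjoint (b h) 1" for h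
  have T: "b h k = T h \<bullet> k" for h k unfolding T_def by (rule linear_functional_inner[OF lr])
  have lT: "linear T"
  proof (rule linearI)
    show "T (x + y) = T x + T y" for x y
      by (rule vector_eq_rdot[THEN iffD1]) (simp add: T[symmetric] inner_add_left linear_add[OF ll])
    show "T (r *\<^sub>R x) = r *\<^sub>R T x" for r x
      by (rule vector_eq_rdot[THEN iffD1]) (simp add: T[symmetric] linear_scale[OF ll])
  qed
  have "inj T"
  proof (subst linear_injective_0[OF lT], intro allI impI)
    fix h assume "T h = 0"
    then have "b h k = 0" "b (- h) k = 0" for k
      using linear_neg[OF ll, of h] by (auto simp: T)
    then have "h \<in> K" "- h \<in> K" unfolding dual[of h] dual[of "- h"] by simp_all
    then show "h = 0" using pointed_no_line K by blast
  qed
  then have surj: "surj T" by (rule linear_injective_imp_surjective[OF lT]) simp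
  have main: "b (P x) (k - P k) = 0" if x: "x \<in> K" for x k
  proof -
    have "linear (\<lambda>k. b (P x) (P k))" using linear_compose[OF lP lr] by (simp add: o_def)
    then obtain a where "b (P x) (P k) = a \<bullet> k" for k using linear_functional_inner by blast
    with surj obtain y where y: "b (P x) (P k) = b y k" for k by (metis T surjD)
    have nonneg: "b (P x) k \<ge> 0" if "k \<in> K" for k
      using PK(1)[OF x] that unfolding dual[of "P x"] by (rule bspec)
    have yK: "y \<in> K"
      unfolding dual[of y] y[symmetric] using nonneg PK(1) by simp
    have zb: "b (P x - y) k = b (P x) (k - P k)" for k
      using y by (simp add: linear_diff[OF ll] linear_diff[OF lr])
    have zK: "P x - y \<in> K"
      unfolding dual[of "P x - y"] zb using nonneg PK(2) by simp
    have "(P x - y) - P (P x - y) = 0"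
      using splits_face(1)[OF K(2,3) splits_compl[OF P] zK yK] by (simp add: idem)
    then have "b (P x - y) (P x - y) = 0" unfolding zb using linear_0[OF lr] by simp
    then have "P x - y = 0" using pos zK by blast
    then show ?thesis using zb[of k] linear_0[OF ll] by simp
  qed
  have lin: "linear (\<lambda>h. b (P h) (k - P k))" for k
    using linear_compose[OF lP ll] by (simp add: o_def)
  have "span K = UNIV"
    using affine_hull_nonempty_interior[OF K(4)] affine_hull_subset_span[of K] by auto
  then have "h \<in> span K" by simp
  then show ?thesis
    using linear_eq_0_on_span[OF lin main] by blast
qed


section \<open>The Hessian of a self-scaled barrier\<close>

text \<open>
  Riesz representation in \<open>V\<close>: the representing vector is the orthogonal projection to \<open>V\<close> of
  the one that represents \<open>g\<close> on the whole space. Taking \<open>g\<close> to be the second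
  derivative of a function on the whole space gives the Hessian of its restriction.
\<close>
lemma hessian_inner:
  assumes "subspace V" "linear g" "\<And>v. v \<in> V \<Longrightarrow> D2 U f x u v = g v"
  shows "hessian V U f x u \<in> V" and "\<And>v. v \<in> V \<Longrightarrow> hessian V U f x u \<bullet> v = g v"
proof -
  let ?a = "adjoint g 1"
  obtain y z where y: "y \<in> span V" and z: "\<And>w. w \<in> span V \<Longrightarrow> orthogonal z w" and a: "?a = y + z"
    using orthogonal_subspace_decomp_exists[of V ?a] by blast
  have sp: "span V = V" using assms(1) by (simp add: span_eq_iff)
  have y': "y \<in> V" using y sp by simp
  have yv: "y \<bullet> v = g v" if "v \<in> V" for v
    using z[of v] that sp a linear_functional_inner[OF assms(2), of v]
    by (simp add: orthogonal_def inner_add_left)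
  have "hessian V U f x u = y"
    unfolding hessian_def
  proof (rule the_equality)
    show "y \<in> V \<and> (\<forall>v\<in>V. y \<bullet> v = D2 U f x u v)" using y' yv assms(3) by simp
    fix w assume w: "w \<in> V \<and> (\<forall>v\<in>V. w \<bullet> v = D2 U f x u v)"
    then have "w - y \<in> V" using y' assms(1) subspace_diff by blast
    moreover have "(w - y) \<bullet> v = 0" if "v \<in> V" for v
      using w yv assms(3) that by (simp add: inner_diff_left)
    ultimately have "(w - y) \<bullet> (w - y) = 0" by blast
    then show "w = y" by simp
  qed
  then show "hessian V U f x u \<in> V" "\<And>v. v \<in> V \<Longrightarrow> hessian V U f x u \<bullet> v = g v"
    using y' yv by simp_all
qed

lemma constant_on_segment:
  fixes f :: "'a::euclidean_space \<Rightarrow> real"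
  assumes "convex U" "x \<in> U" "y \<in> U"
    and "\<And>z. z \<in> U \<Longrightarrow> (f has_derivative f' z) (at z)"
    and "\<And>z. z \<in> U \<Longrightarrow> f' z (y - x) = 0"
  shows "f y = f x"
proof -
  let ?l = "\<lambda>t::real. x + t *\<^sub>R (y - x)"
  have l: "?l t \<in> U" if "0 \<le> t" "t \<le> 1" for t
  proof -
    have "(1 - t) *\<^sub>R x + t *\<^sub>R y \<in> U" using assms(1-3) that by (simp add: convex_alt)
    then show ?thesis by (simp add: algebra_simps)
  qed
  have "((\<lambda>t. f (?l t)) has_derivative (\<lambda>s. f' (?l t) (s *\<^sub>R (y - x)))) (at t within {0..1})"
    if "0 \<le> t" "t \<le> 1" for t
  proof -
    have "t \<in> {0..1}" using that by simp
    have "(?l has_derivative (\<lambda>t. t *\<^sub>R (y - x))) (at t within {0..1})"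
      by (auto intro!: derivative_eq_intros)
    from has_derivative_compose[OF this assms(4)[OF l[OF that]]] show ?thesis .
  qed
  from mvt_simple[OF zero_less_one this]
  obtain t where t: "t \<in> {0<..<1}" "f (?l 1) - f (?l 0) = f' (?l t) ((1 - 0) *\<^sub>R (y - x))"
    by blast
  then show ?thesis using assms(5)[OF l[of t]] by simp
qed

text \<open>
  A self-scaled barrier on a full-dimensional cone. Its parameter \<open>\<nu>\<close> is fixed in the locale, since the
  parameters of the blocks have to add up to it.
\<close>
locale scaled_barrier =
  fixes K :: "'a::euclidean_space set" and F :: "'a \<Rightarrow> real" and \<nu> :: real
  assumes regular: "regular_cone UNIV K"
    and barrier: "self_concordant_barrier UNIV K F"
    and log_homogeneous: "\<And>x t. x \<in> interior K \<Longrightarrow> t > 0 \<Longrightarrow> F (t *\<^sub>R x) = F x - \<nu> * ln t"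
    and scaled_dual: "\<And>x w. x \<in> interior K \<Longrightarrow> w \<in> interior K \<Longrightarrow>
      hessian UNIV (interior K) F w x \<in> interior (dual_cone UNIV (\<bullet>) K)"
    and scaled_conjugate: "\<And>x w. x \<in> interior K \<Longrightarrow> w \<in> interior K \<Longrightarrow>
      conjugate_barrier UNIV K F (hessian UNIV (interior K) F w x) = ereal (F x - 2 * F w - \<nu>)"
begin

abbreviation "U \<equiv> interior K"
abbreviation "DF \<equiv> D1 U F"
abbreviation "H \<equiv> D2 U F"

lemma K_props: "closed K" "convex K" "cone K" "pointed K" "U \<noteq> {}"
  using regular by (auto simp: regular_cone_def int_in_UNIV)

lemma convex_U: "convex U"
  using K_props(2) by (rule convex_interior)

lemma smooth: "Ck_on 3 UNIV U F"
  and convex_F: "convex_on U F"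
  and blows_up: "(\<And>n. X n \<in> U) \<Longrightarrow> X \<longlonglongrightarrow> p \<Longrightarrow> p \<in> K \<Longrightarrow> p \<notin> U \<Longrightarrow>
      filterlim (\<lambda>n. F (X n)) at_top sequentially"
  and D3_bound: "x \<in> U \<Longrightarrow> \<bar>D3 U F x h h h\<bar> \<le> 2 * H x h h powr (3/2)"
  and D1_bound: "\<exists>\<nu>. \<forall>x\<in>U. \<forall>h. \<bar>DF x h\<bar>\<^sup>2 \<le> \<nu> * H x h h"
proof -
  note * = barrier[unfolded self_concordant_barrier_def int_in_UNIV Let_def]
  show "Ck_on 3 UNIV U F" "convex_on U F" using * by blast+
  show "filterlim (\<lambda>n. F (X n)) at_top sequentially"
    if "\<And>n. X n \<in> U" "X \<longlonglongrightarrow> p" "p \<in> K" "p \<notin> U"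
  proof -
    have "p \<in> top_of_set UNIV frontier_of K"
      using that closure_subset by (auto simp: frontier_def)
    then show ?thesis using * that(1,2) by blast
  qed
  show "\<bar>D3 U F x h h h\<bar> \<le> 2 * H x h h powr (3/2)" if "x \<in> U" using * that by blast
  show "\<exists>\<nu>. \<forall>x\<in>U. \<forall>h. \<bar>DF x h\<bar>\<^sup>2 \<le> \<nu> * H x h h" using * by simp
qed

lemma differentiable: "F differentiable_on U" "(\<lambda>y. DF y h) differentiable_on U"
  using smooth by (simp_all add: numeral_3_eq_3)

lemma DF: "x \<in> U \<Longrightarrow> (F has_derivative DF x) (at x)"
  by (rule D1_has_derivative[OF open_interior _ differentiable(1)])

lemma DDF: "x \<in> U \<Longrightarrow> ((\<lambda>y. DF y h) has_derivative H x h) (at x)"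
proof -
  assume x: "x \<in> U"
  have "H x h = D1 U (\<lambda>y. DF y h) x" by (simp add: D2_def fun_eq_iff)
  then show ?thesis using D1_has_derivative[OF open_interior x differentiable(2)] by metis
qed

lemma linear_DF: "x \<in> U \<Longrightarrow> linear (DF x)"
  using DF has_derivative_linear by blast

lemma linear_H: "x \<in> U \<Longrightarrow> linear (H x h)"
  using DDF has_derivative_linear by blast

lemma bilinear_H: assumes x: "x \<in> U" shows "bilinear (H x)"
  unfolding bilinear_def
proof (intro conjI allI)
  show "linear (H x h)" for h by (rule linear_H[OF x])
  show "linear (\<lambda>h. H x h k)" for k
  proof (rule linearI)
    fix h h'
    have "((\<lambda>y. DF y (h + h')) has_derivative (\<lambda>k. H x h k + H x h' k)) (at x)"
      by (rule has_derivative_transform_within_open[OF has_derivative_add[OF DDF[OF x] DDF[OF x]]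
            open_interior x]) (simp add: linear_add[OF linear_DF])
    from has_derivative_unique[OF DDF[OF x] this]
    show "H x (h + h') k = H x h k + H x h' k" by metis
  next
    fix r h
    have "((\<lambda>y. DF y (r *\<^sub>R h)) has_derivative (\<lambda>k. r *\<^sub>R H x h k)) (at x)"
      by (rule has_derivative_transform_within_open[OF has_derivative_scaleR_right[OF DDF[OF x]]
            open_interior x]) (simp add: linear_scale[OF linear_DF])
    from has_derivative_unique[OF DDF[OF x] this]
    show "H x (r *\<^sub>R h) k = r *\<^sub>R H x h k" by metis
  qed
qed

lemmas H_simps = bilinear_ladd[OF bilinear_H] bilinear_radd[OF bilinear_H]
  bilinear_lsub[OF bilinear_H] bilinear_rsub[OF bilinear_H]
  bilinear_lmul[OF bilinear_H] bilinear_rmul[OF bilinear_H]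
  bilinear_lneg[OF bilinear_H] bilinear_rneg[OF bilinear_H]
  bilinear_lzero[OF bilinear_H] bilinear_rzero[OF bilinear_H]

lemma hessian_H: "w \<in> U \<Longrightarrow> hessian UNIV U F w h \<bullet> k = H w h k"
  by (rule hessian_inner(2)[OF subspace_UNIV linear_H]) auto

lemma scale_U: assumes "x \<in> U" "t > 0" shows "t *\<^sub>R x \<in> U"
proof -
  let ?S = "(\<lambda>z. inverse t *\<^sub>R z) -` U"
  have "open ?S" by (rule open_vimage) (auto intro!: continuous_intros)
  moreover have "t *\<^sub>R x \<in> ?S" using assms by simp
  moreover have "?S \<subseteq> K"
  proof
    fix z assume "z \<in> ?S"
    then have "inverse t *\<^sub>R z \<in> K" using interior_subset by auto
    then have "t *\<^sub>R (inverse t *\<^sub>R z) \<in> K" using K_props(3) assms(2) by (simp only: cone_def)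
    then show "z \<in> K" using assms(2) by simp
  qed
  ultimately show ?thesis by (meson interiorI)
qed

lemma add_U: assumes "x \<in> U" "k \<in> K" shows "x + k \<in> U"
proof -
  let ?S = "(\<lambda>z. z - k) -` U"
  have "open ?S" by (rule open_vimage) (auto intro!: continuous_intros)
  moreover have "x + k \<in> ?S" using assms by simp
  moreover have "?S \<subseteq> K"
  proof
    fix z assume "z \<in> ?S"
    then have "z - k \<in> K" using interior_subset by auto
    then have "(z - k) + k \<in> K" using convex_cone_add K_props assms(2) by blast
    then show "z \<in> K" by simp
  qed
  ultimately show ?thesis by (meson interiorI)
qed

text \<open>
  The next three lemmas differentiate the logarithmic homogeneity of \<open>F\<close>, in the point or along the ray
  through it.
\<close>
lemma DF_scale: assumes x: "x \<in> U" and t: "t > 0" shows "DF (t *\<^sub>R x) h = DF x h / t"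
proof -
  have "((\<lambda>y. t *\<^sub>R y) has_derivative (\<lambda>h. t *\<^sub>R h)) (at x)"
    by (auto intro!: derivative_eq_intros)
  from has_derivative_compose[OF this DF[OF scale_U[OF x t]]]
  have 1: "((\<lambda>y. F (t *\<^sub>R y)) has_derivative (\<lambda>h. DF (t *\<^sub>R x) (t *\<^sub>R h))) (at x)" .
  have "((\<lambda>y. F y - \<nu> * ln t) has_derivative DF x) (at x)"
    using DF[OF x] by (auto intro!: derivative_eq_intros)
  then have 2: "((\<lambda>y. F (t *\<^sub>R y)) has_derivative DF x) (at x)"
    by (rule has_derivative_transform_within_open[OF _ open_interior x])
      (simp add: log_homogeneous t)
  have "DF (t *\<^sub>R x) (t *\<^sub>R h) = DF x h"
    using fun_cong[OF has_derivative_unique[OF 1 2]] .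
  then show ?thesis
    using t linear_scale[OF linear_DF[OF scale_U[OF x t]], of t h] by (simp add: field_simps)
qed

lemma ray_deriv: "((\<lambda>t. t *\<^sub>R x) has_derivative (\<lambda>t. t *\<^sub>R x)) (at (1::real))"
  by (auto intro!: derivative_eq_intros)

lemma DF_self: assumes x: "x \<in> U" shows "DF x x = - \<nu>"
proof -
  have "x = 1 *\<^sub>R x" by simp
  then have "(F has_derivative DF x) (at (1 *\<^sub>R x))" using DF[OF x] by simp
  from has_derivative_compose[OF ray_deriv this]
  have 1: "((\<lambda>t. F (t *\<^sub>R x)) has_derivative (\<lambda>t. DF x (t *\<^sub>R x))) (at 1)" .
  have "((\<lambda>t. F x - \<nu> * ln t) has_derivative (\<lambda>t. - \<nu> * t)) (at (1::real))"
    by (auto intro!: derivative_eq_intros)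
  then have 2: "((\<lambda>t. F (t *\<^sub>R x)) has_derivative (\<lambda>t. - \<nu> * t)) (at 1)"
    by (rule has_derivative_transform_within_open[OF _ open_greaterThan[of 0]])
      (simp_all add: log_homogeneous x)
  show ?thesis using fun_cong[OF has_derivative_unique[OF 1 2], of 1] by simp
qed

lemma H_self: assumes x: "x \<in> U" shows "H x h x = - DF x h"
proof -
  have "((\<lambda>y. DF y h) has_derivative H x h) (at (1 *\<^sub>R x))" using DDF[OF x] by simp
  from has_derivative_compose[OF ray_deriv this]
  have 1: "((\<lambda>t. DF (t *\<^sub>R x) h) has_derivative (\<lambda>t. H x h (t *\<^sub>R x))) (at 1)" .
  have "((\<lambda>t. DF x h / t) has_derivative (\<lambda>t. - DF x h * t)) (at (1::real))"
    by (auto intro!: derivative_eq_intros)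
  then have 2: "((\<lambda>t. DF (t *\<^sub>R x) h) has_derivative (\<lambda>t. - DF x h * t)) (at 1)"
    by (rule has_derivative_transform_within_open[OF _ open_greaterThan[of 0]])
      (simp_all add: DF_scale x)
  show ?thesis using fun_cong[OF has_derivative_unique[OF 1 2], of 1] by simp
qed

text \<open>
  Scaled duality gives this for interior \<open>h\<close>; a boundary point is reached by adding a small multiple of \<open>w\<close>.
\<close>
lemma H_nonneg: assumes w: "w \<in> U" and "h \<in> K" "k \<in> K" shows "H w h k \<ge> 0"
proof (rule ccontr)
  assume neg: "\<not> H w h k \<ge> 0"
  have pos: "H w x k \<ge> 0" if "x \<in> U" for x
  proof -
    have "hessian UNIV U F w x \<in> dual_cone UNIV (\<bullet>) K"
      using scaled_dual[OF that w] interior_subset by blast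
    then have "k \<bullet> hessian UNIV U F w x \<ge> 0" using assms(3) by (simp add: dual_cone_def)
    then show ?thesis using hessian_H[OF w] by (simp add: inner_commute)
  qed
  \<comment> \<open>small enough that \<open>?e *\<^sub>R w\<close> cannot make up for the negative value at \<open>h\<close>; the summand 1 keeps the
    denominator positive\<close>
  let ?e = "- H w h k / (1 + H w w k)"
  have p: "1 + H w w k > 0" using pos[OF w] by simp
  then have e: "?e > 0" using neg by (intro divide_pos_pos) auto
  have "?e *\<^sub>R w + h \<in> U" using add_U[OF scale_U[OF w e] assms(2)] .
  from pos[OF this] have "?e * H w w k + H w h k \<ge> 0"
    using H_simps[OF w] by simp
  moreover have "?e * H w w k = - H w h k - ?e" using p by (simp add: field_simps)
  ultimately show False using e by simp
qed

lemma conjugate_lower: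
  assumes "x \<in> U" "w \<in> U" "y \<in> U"
  shows "- H w x y - F y \<le> F x - 2 * F w - \<nu>"
proof -
  have "ereal (- (y \<bullet> hessian UNIV U F w x) - F y) \<le> conjugate_barrier UNIV K F (hessian UNIV U F w x)"
    unfolding conjugate_barrier_def int_in_UNIV using assms(3) by (rule SUP_upper)
  then show ?thesis
    using scaled_conjugate[OF assms(1,2)] hessian_H[OF assms(2)] by (simp add: inner_commute)
qed

lemma conjugate_least:
  assumes "x \<in> U" "w \<in> U" and "\<And>y. y \<in> U \<Longrightarrow> - H w x y - F y \<le> c"
  shows "F x - 2 * F w - \<nu> \<le> c"
proof -
  have "conjugate_barrier UNIV K F (hessian UNIV U F w x) \<le> ereal c"
    unfolding conjugate_barrier_def int_in_UNIV
    using assms(3) hessian_H[OF assms(2)] by (intro SUP_least) (simp add: inner_commute)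
  then show ?thesis using scaled_conjugate[OF assms(1,2)] by simp
qed

text \<open>
  The hypothesis says that \<open>F''(w) x\<close> dominates \<open>F''(w) y\<close> in the order of the dual cone. The conjugate \<open>F\<^sub>*\<close>
  decreases in this order, and its values at the two points are \<open>F x\<close> and \<open>F y\<close> up to the same
  constant.
\<close>
lemma F_le_of_H_le:
  assumes "x \<in> U" "y \<in> U" "w \<in> U" and "\<And>k. k \<in> K \<Longrightarrow> H w y k \<le> H w x k"
  shows "F x \<le> F y"
proof -
  have "F x - 2 * F w - \<nu> \<le> F y - 2 * F w - \<nu>"
  proof (rule conjugate_least[OF assms(1,3)])
    fix z assume z: "z \<in> U"
    then have "H w y z \<le> H w x z" using assms(4) interior_subset by blast
    then show "- H w x z - F z \<le> F y - 2 * F w - \<nu>"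
      using conjugate_lower[OF assms(2,3) z] by simp
  qed
  then show ?thesis by simp
qed

text \<open>
  This is the statement that \<open>F''(w)\<close> maps \<open>K\<close> onto \<open>K\<^sup>*\<close>. If \<open>h\<close> satisfied the right-hand side outside \<open>K\<close>,
  the segment from \<open>w\<close> to \<open>h\<close> would meet the boundary in \<open>p = (1 - t) w + t h\<close> with \<open>t < 1\<close>.
  Before \<open>p\<close> each point of the segment is at least \<open>(1 - t) w\<close> plus a non-negative multiple of
  \<open>h\<close>, so \<open>F\<close> is bounded there by \<open>F ((1 - t) w)\<close>, although it must blow up at \<open>p\<close>.
\<close>
lemma H_dual:
  assumes w: "w \<in> U"
  shows "h \<in> K \<longleftrightarrow> (\<forall>k\<in>K. H w h k \<ge> 0)"
proof
  assume "h \<in> K"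
  then show "\<forall>k\<in>K. H w h k \<ge> 0" using H_nonneg[OF w] by blast
next
  assume h: "\<forall>k\<in>K. H w h k \<ge> 0"
  show "h \<in> K"
  proof (rule ccontr)
    assume "h \<notin> K"
    then have "closed_segment w h - K \<noteq> {}" by auto
    moreover have "closed_segment w h \<inter> K \<noteq> {}" using w interior_subset by fastforce
    ultimately have "closed_segment w h \<inter> frontier K \<noteq> {}"
      by (intro connected_Int_frontier) auto
    then obtain p where p: "p \<in> closed_segment w h" "p \<in> K" "p \<notin> U"
      using K_props(1) by (auto simp: frontier_def)
    then obtain t where t: "0 \<le> t" "t \<le> 1" and pt: "p = (1 - t) *\<^sub>R w + t *\<^sub>R h"
      by (auto simp: in_segment)
    have "t \<noteq> 1" using pt p(2) \<open>h \<notin> K\<close> by auto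
    then have d: "1 - t > 0" using t by simp
    define e where "e n = inverse (real (Suc n))" for n
    define X where "X n = p - e n *\<^sub>R (p - w)" for n
    have e: "0 < e n" "e n \<le> 1" for n by (simp_all add: e_def inverse_le_1_iff)
    have XU: "X n \<in> U" for n
      unfolding X_def using mem_interior_convex_shrink[OF K_props(2) w p(2) e] .
    have "X \<longlonglongrightarrow> p - 0 *\<^sub>R (p - w)"
      unfolding X_def e_def
      by (intro tendsto_intros LIMSEQ_inverse_real_of_nat)
    then have "X \<longlonglongrightarrow> p" by simp
    from blows_up[OF XU this p(2,3)]
    obtain n where n: "F (X n) \<ge> F ((1 - t) *\<^sub>R w) + 1"
      unfolding filterlim_at_top eventually_sequentially by blast
    have "F (X n) \<le> F ((1 - t) *\<^sub>R w)"
    proof (rule F_le_of_H_le[OF XU scale_U[OF w d] w])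
      fix k assume k: "k \<in> K"
      have Xn: "X n = (1 - t * (1 - e n)) *\<^sub>R w + (t * (1 - e n)) *\<^sub>R h"
        unfolding X_def pt by (simp add: algebra_simps)
      have "(1 - t) * H w w k \<le> (1 - t * (1 - e n)) * H w w k"
        using H_nonneg[OF w _ k, of w] w interior_subset[of K] t e[of n]
        by (intro mult_right_mono) (auto simp: algebra_simps)
      moreover have "0 \<le> (t * (1 - e n)) * H w h k" using h k t e[of n] by simp
      ultimately show "H w ((1 - t) *\<^sub>R w) k \<le> H w (X n) k"
        unfolding Xn using H_simps[OF w] by simp
    qed
    then show False using n by simp
  qed
qed

text \<open>
  If \<open>H w k k = 0\<close>, the barrier inequality kills \<open>DF w k = - H w k w\<close>. So the functional \<open>H w k\<close>, which
  is non-negative on \<open>K\<close>, vanishes at the interior point \<open>w\<close> and is therefore zero; then both \<open>k\<close> and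
  \<open>- k\<close> lie in \<open>K\<close> by self-duality.
\<close>
lemma H_definite:
  assumes w: "w \<in> U" and k: "k \<in> K" "k \<noteq> 0"
  shows "H w k k \<noteq> 0"
proof
  assume 0: "H w k k = 0"
  obtain \<nu>' where "\<bar>DF w k\<bar>\<^sup>2 \<le> \<nu>' * H w k k" using D1_bound w by blast
  then have "DF w k = 0" using 0 by simp
  then have kw: "H w k w = 0" using H_self[OF w] by simp
  obtain \<epsilon> where e: "\<epsilon> > 0" "ball w \<epsilon> \<subseteq> K" using w mem_interior by blast
  have z: "H w k u = 0" for u
  proof (cases "u = 0")
    case True
    then show ?thesis using H_simps[OF w] by simp
  next
    case False
    define s where "s = \<epsilon> / (2 * norm u)"
    have s: "s > 0" "norm (s *\<^sub>R u) < \<epsilon>" using False e(1) by (simp_all add: s_def)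
    then have "w + s *\<^sub>R u \<in> K" "w - s *\<^sub>R u \<in> K" using e(2) by (auto simp: subset_eq dist_norm)
    from this[THEN H_nonneg[OF w k(1)]]
    have "s * H w k u \<ge> 0" "- (s * H w k u) \<ge> 0" using kw H_simps[OF w] by simp_all
    then show ?thesis using s(1) by simp
  qed
  then have "- k \<in> K" unfolding H_dual[OF w, of "- k"] using H_simps[OF w] by simp
  then show False using pointed_no_line K_props k by blast
qed


subsection \<open>Splitting the barrier along a projection\<close>

context
  fixes P assumes P: "splits P K"
begin

lemma linear_P: "linear P" and idem: "P (P x) = P x"
  and P_K: "x \<in> K \<Longrightarrow> P x \<in> K" "x \<in> K \<Longrightarrow> x - P x \<in> K"
  using P by (auto simp: splits_def)

lemmas P_simps = linear_add[OF linear_P] linear_diff[OF linear_P] linear_scale[OF linear_P]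
  linear_0[OF linear_P] linear_neg[OF linear_P] idem

lemma exchange_U: "x \<in> U \<Longrightarrow> y \<in> U \<Longrightarrow> P x + (y - P y) \<in> U"
  by (rule interior_exchange[OF K_props(2,3) P])

lemma H_cross: assumes "w \<in> U" shows "H w (P h) (k - P k) = 0"
  by (rule splits_orthogonal[OF K_props(2-5) P bilinear_H[OF assms] H_dual[OF assms]
        H_definite[OF assms]])

text \<open>
  Mixed second derivatives vanish, so partial derivatives in one block do not feel a change of the
  other block.
\<close>
lemma DF_P_indep:
  assumes "x \<in> U" "y \<in> U" "P x = P y"
  shows "DF y (P h) = DF x (P h)"
proof (rule constant_on_segment[OF convex_U assms(1,2) DDF])
  fix z assume z: "z \<in> U"
  have "y - x = (y - x) - P (y - x)" using assms(3) by (simp add: P_simps)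
  then show "H z (P h) (y - x) = 0" using H_cross[OF z, of h "y - x"] by simp
qed

end

lemma H_cross': assumes "splits P K" "w \<in> U" shows "H w (h - P h) (P k) = 0"
  using H_cross[OF splits_compl[OF assms(1)] assms(2), of h k] by simp

lemma H_blocks:
  assumes "splits P K" "w \<in> U"
  shows "H w x y = H w (P x) (P y) + H w (x - P x) (y - P y)"
proof -
  have "H w x y = H w (P x + (x - P x)) (P y + (y - P y))" by simp
  also have "\<dots> = H w (P x) (P y) + H w (x - P x) (y - P y)"
    unfolding bilinear_ladd[OF bilinear_H[OF assms(2)]] bilinear_radd[OF bilinear_H[OF assms(2)]]
    using H_cross[OF assms, of x y] H_cross'[OF assms, of x y] by simp
  finally show ?thesis .
qed

text \<open>
  This is the additive splitting of \<open>F\<close> written without naming the summands. For fixed \<open>y\<close> the difference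
  \<open>F z - F (P y + (z - P z))\<close> has no derivative in the directions \<open>k - P k\<close>, so it keeps its value
  when the second coordinate of \<open>x\<close> is replaced by that of \<open>y\<close>.
\<close>
lemma F_exchange:
  assumes P: "splits P K" and x: "x \<in> U" and y: "y \<in> U"
  shows "F x + F y = F (P x + (y - P y)) + F (P y + (x - P x))"
proof -
  note Ps = P_simps[OF P]
  let ?g = "\<lambda>z. P y + (z - P z)"
  let ?x = "P x + (y - P y)"
  have gU: "?g z \<in> U" if "z \<in> U" for z using exchange_U[OF P y that] .
  have xU: "?x \<in> U" using exchange_U[OF P x y] .
  have dP: "(P has_derivative P) (at z)" for z
    by (rule linear_imp_has_derivative[OF linear_P[OF P]])
  have dg: "(?g has_derivative (\<lambda>h. h - P h)) (at z)" for z
    by (rule derivative_eq_intros dP refl | simp)+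
  have d: "((\<lambda>z. F z - F (?g z)) has_derivative (\<lambda>h. DF z h - DF (?g z) (h - P h))) (at z)"
    if "z \<in> U" for z
    by (rule has_derivative_diff[OF DF[OF that] has_derivative_compose[OF dg DF[OF gU[OF that]]]])
  have "F ?x - F (?g ?x) = F x - F (?g x)"
  proof (rule constant_on_segment[OF convex_U x xU d])
    fix z assume z: "z \<in> U"
    let ?h = "(y - x) - P (y - x)"
    have h: "?x - x = ?h" "?h - P ?h = ?h" by (simp_all add: Ps)
    have "DF (?g z) ?h = DF z ?h"
      by (rule DF_P_indep[OF splits_compl[OF P] z gU[OF z]]) (simp add: Ps)
    then show "DF z (?x - x) - DF (?g z) ((?x - x) - P (?x - x)) = 0" unfolding h by simp
  qed
  moreover have "?g ?x = y" by (simp add: Ps)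
  ultimately show ?thesis by simp
qed

text \<open>
  Euler's relation \<open>DF z z = - \<nu>\<close> writes a constant as a function of the first coordinate of \<open>z\<close> plus a
  function of the second, so each of the two is constant.
\<close>
lemma DF_P_const:
  assumes P: "splits P K" and x: "x \<in> U" and e: "e \<in> U"
  shows "DF x (P x) = DF e (P e)"
proof -
  note Ps = P_simps[OF P]
  let ?z = "P x + (e - P e)"
  have z: "?z \<in> U" using exchange_U[OF P x e] .
  have Pz: "P ?z = P x" "?z - P ?z = e - P e" by (simp_all add: Ps)
  have "DF ?z (P x) = DF x (P x)" by (rule DF_P_indep[OF P x z]) (simp add: Ps)
  moreover have "DF ?z (e - P e) = DF e (e - P e)"
    by (rule DF_P_indep[OF splits_compl[OF P] e z]) (simp add: Ps)
  moreover have "DF ?z (P x) + DF ?z (e - P e) = - \<nu>"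
    using DF_self[OF z] linear_add[OF linear_DF[OF z]] by simp
  moreover have "DF e (P e) + DF e (e - P e) = - \<nu>"
    using DF_self[OF e] linear_add[OF linear_DF[OF e], of "P e" "e - P e"] by simp
  ultimately show ?thesis by simp
qed

text \<open>
  The barrier parameter of the block \<open>P\<close>, read off from Euler's relation in the block. By \<open>DF_P_const\<close> the
  base point does not matter.
\<close>
definition deg :: "('a \<Rightarrow> 'a) \<Rightarrow> real" where
  "deg P = - DF (SOME e. e \<in> U) (P (SOME e. e \<in> U))"

lemma DF_P: assumes "splits P K" "x \<in> U" shows "DF x (P x) = - deg P"
  using DF_P_const[OF assms(1,2), of "SOME e. e \<in> U"] K_props(5)
  by (simp add: deg_def some_in_eq)

lemma deg_compl: assumes "splits P K" shows "deg (\<lambda>x. x - P x) = \<nu> - deg P"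
proof -
  obtain e where e: "e \<in> U" using K_props(5) by blast
  show ?thesis
    using DF_P[OF assms e] DF_P[OF splits_compl[OF assms] e] DF_self[OF e]
      linear_add[OF linear_DF[OF e], of "P e" "e - P e"] by simp
qed

lemma H_P: assumes P: "splits P K" and x: "x \<in> U" shows "H x (P x) (P x) = deg P"
  using H_blocks[OF P x, of "P x" x] H_self[OF x, of "P x"] DF_P[OF P x] H_simps[OF x]
  by (simp add: P_simps[OF P])

lemma partial_scale_U:
  assumes "splits P K" "x \<in> U" "t > 0"
  shows "t *\<^sub>R P x + (x - P x) \<in> U"
  using exchange_U[OF assms(1) scale_U[OF assms(2,3)] assms(2)] by (simp add: P_simps[OF assms(1)])

text \<open>
  Logarithmic homogeneity in one block is Euler's relation of that block, integrated along a ray.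
\<close>
lemma F_partial_scale:
  assumes P: "splits P K" and x: "x \<in> U" and t: "t > 0"
  shows "F (t *\<^sub>R P x + (x - P x)) = F x - deg P * ln t"
proof -
  let ?l = "\<lambda>t. t *\<^sub>R P x + (x - P x)"
  have d: "((\<lambda>t. F (?l t) + deg P * ln t) has_derivative
      (\<lambda>s. DF (?l u) (s *\<^sub>R P x) + deg P * (s / u))) (at u)" if u: "u > 0" for u
  proof -
    have "(?l has_derivative (\<lambda>s. s *\<^sub>R P x)) (at u)"
      by (auto intro!: derivative_eq_intros)
    from has_derivative_compose[OF this DF[OF partial_scale_U[OF P x u]]]
    have "((\<lambda>t. F (?l t)) has_derivative (\<lambda>s. DF (?l u) (s *\<^sub>R P x))) (at u)" .
    moreover have "((\<lambda>t. deg P * ln t) has_derivative (\<lambda>s. deg P * (s / u))) (at u)"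
      using u by (auto intro!: derivative_eq_intros simp: field_simps)
    ultimately show ?thesis by (rule has_derivative_add)
  qed
  have "F (?l t) + deg P * ln t = F (?l 1) + deg P * ln 1"
  proof (rule constant_on_segment[where U = "{0<..}" and f = "\<lambda>t. F (?l t) + deg P * ln t" and
        f' = "\<lambda>u s. DF (?l u) (s *\<^sub>R P x) + deg P * (s / u)"])
    fix u :: real assume "u \<in> {0<..}"
    then have u: "u > 0" by simp
    then show "((\<lambda>t. F (?l t) + deg P * ln t) has_derivative
      (\<lambda>s. DF (?l u) (s *\<^sub>R P x) + deg P * (s / u))) (at u)" by (rule d)
    note lu = partial_scale_U[OF P x u]
    have "u * DF (?l u) (P x) = - deg P"
      using DF_P[OF P lu] linear_scale[OF linear_DF[OF lu]] by (simp add: P_simps[OF P])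
    then have "DF (?l u) (P x) = - deg P / u" using u by (simp add: field_simps)
    then show "DF (?l u) ((t - 1) *\<^sub>R P x) + deg P * ((t - 1) / u) = 0"
      using linear_scale[OF linear_DF[OF lu], of "t - 1" "P x"] by simp
  qed (use t in auto)
  then show ?thesis by simp
qed

text \<open>
  Letting the block coordinate \<open>P x\<close> shrink to zero leads to a boundary point of \<open>K\<close>. There \<open>F\<close>
  tends to infinity, whereas it grows by \<open>deg P\<close> times a logarithm.
\<close>
lemma deg_pos:
  assumes P: "splits P K" and nz: "range P \<noteq> {0}"
  shows "deg P > 0"
proof -
  note Ps = P_simps[OF P]
  obtain x where x: "x \<in> U" using K_props(5) by blast
  define X where "X n = inverse (real (Suc n)) *\<^sub>R P x + (x - P x)" for n
  have XU: "X n \<in> U" for n unfolding X_def by (rule partial_scale_U[OF P x]) simp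
  have "X \<longlonglongrightarrow> 0 *\<^sub>R P x + (x - P x)"
    unfolding X_def by (intro tendsto_intros LIMSEQ_inverse_real_of_nat)
  then have lim: "X \<longlonglongrightarrow> x - P x" by simp
  have K: "x - P x \<in> K" using P_K(2)[OF P] x interior_subset by blast
  have "\<exists>a. P a \<noteq> 0"
  proof (rule ccontr)
    assume "\<not> (\<exists>a. P a \<noteq> 0)"
    then have "range P = {0}" by auto
    then show False using nz by simp
  qed
  then obtain v where v: "v \<noteq> 0" "P v = v" using Ps(6) by blast
  have "x - P x \<notin> U"
  proof
    assume "x - P x \<in> U"
    then obtain \<epsilon> where e: "\<epsilon> > 0" "ball (x - P x) \<epsilon> \<subseteq> K" using mem_interior by blast
    define s where "s = \<epsilon> / (2 * norm v)"
    have s: "s > 0" "norm (s *\<^sub>R v) < \<epsilon>" using v(1) e(1) by (simp_all add: s_def)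
    then have "(x - P x) + s *\<^sub>R v \<in> K" "(x - P x) - s *\<^sub>R v \<in> K"
      using e(2) by (auto simp: subset_eq dist_norm)
    from this[THEN P_K(1)[OF P]] have "s *\<^sub>R v \<in> K" "- (s *\<^sub>R v) \<in> K"
      using v(2) by (simp_all add: Ps)
    then have "s *\<^sub>R v = 0" using pointed_no_line K_props by blast
    then show False using s(1) v(1) by simp
  qed
  from blows_up[OF XU lim K this]
  obtain n where "F (X n) \<ge> F x + 1"
    unfolding filterlim_at_top eventually_sequentially by blast
  moreover have "F (X n) = F x + deg P * ln (real (Suc n))"
    unfolding X_def using F_partial_scale[OF P x, of "inverse (real (Suc n))"]
    by (simp add: ln_inverse)
  ultimately have "deg P * ln (real (Suc n)) > 0" by simp
  moreover have "ln (real (Suc n)) \<ge> 0" by simp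
  ultimately show ?thesis by (simp add: zero_less_mult_iff)
qed

text \<open>
  One competitor in the supremum that defines the conjugate: both points get the second coordinate of
  \<open>w\<close>, whose contribution \<open>H w (w - P w) (w - P w)\<close> is the parameter of the complementary block.
\<close>
lemma partial_conjugate_upper:
  assumes P: "splits P K" and w: "w \<in> U" and x: "x \<in> U" and y: "y \<in> U"
  shows "- H w (P x) (P y) - F (P y + (w - P w)) \<le> F (P x + (w - P w)) - 2 * F w - deg P"
proof -
  note Ps = P_simps[OF P]
  let ?x = "P x + (w - P w)" and ?y = "P y + (w - P w)"
  have "H w ?x ?y = H w (P x) (P y) + H w (w - P w) (w - P w)"
    using H_blocks[OF P w, of ?x ?y] by (simp add: Ps)
  also have "\<dots> = H w (P x) (P y) + (\<nu> - deg P)"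
    using H_P[OF splits_compl[OF P] w] deg_compl[OF P] by simp
  finally show ?thesis
    using conjugate_lower[OF exchange_U[OF P x w] w exchange_U[OF P y w]] by simp
qed

text \<open>
  The scaling identity for the conjugate of the block. The upper bound is known. For the lower bound,
  the supremum for the whole cone splits by \<open>H_blocks\<close> and \<open>F_exchange\<close>, and the upper
  bound applied to the complementary block at \<open>w\<close> itself removes the second half.
\<close>
lemma partial_conjugate:
  assumes P: "splits P K" and w: "w \<in> U" and x: "x \<in> U"
  shows "(SUP p\<in>P ` U. ereal (- H w (P x) p - F (p + (w - P w)))) =
      ereal (F (P x + (w - P w)) - 2 * F w - deg P)" (is "?S = ereal ?c")
proof (rule antisym)
  note Ps = P_simps[OF P]
  show upper: "?S \<le> ereal ?c"
    using partial_conjugate_upper[OF P w x] by (intro SUP_least) auto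
  have summand: "ereal (- H w (P x) (P y) - F (P y + (w - P w))) \<le> ?S" if "y \<in> U" for y
    using that by (intro SUP_upper) auto
  then obtain r where r: "?S = ereal r" using upper x by (cases ?S) force+
  let ?x = "P x + (w - P w)"
  have "F ?x - 2 * F w - \<nu> \<le> r - (\<nu> - deg P)"
  proof (rule conjugate_least[OF exchange_U[OF P x w] w])
    fix y assume y: "y \<in> U"
    have "H w ?x y = H w (P x) (P y) + H w (w - P w) (y - P y)"
      using H_blocks[OF P w, of ?x y] by (simp add: Ps)
    moreover have "- H w (w - P w) (y - P y) - F ((y - P y) + P w) \<le> - F w - (\<nu> - deg P)"
      using partial_conjugate_upper[OF splits_compl[OF P] w w y] deg_compl[OF P] by simp
    moreover have "F w + F y = F (P w + (y - P y)) + F (P y + (w - P w))"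
      by (rule F_exchange[OF P w y])
    moreover have "- H w (P x) (P y) - F (P y + (w - P w)) \<le> r"
      using summand[OF y] r by simp
    ultimately show "- H w ?x y - F y \<le> r - (\<nu> - deg P)" by (simp add: add.commute)
  qed
  then show "ereal ?c \<le> ?S" using r by simp
qed


text \<open>
  All derivatives of the frozen function are derivatives of \<open>F\<close> at the shifted point in directions of
  \<open>V\<close>. Its Hessian represents the restriction of \<open>H\<close> to \<open>V\<close>; on a vector of \<open>V\<close> the form
  \<open>H\<close> sees only the \<open>V\<close>-part of its other argument, which yields both the non-degeneracy of the
  restriction and the comparison with \<open>F''\<close> on the dual cone. \<open>V\<close> and its complement need
  not be orthogonal, so the Hessian of the block is not the restriction of \<open>F''\<close>.
\<close>
lemma self_scaled_block:
  assumes P: "splits P K" and nz: "range P \<noteq> {0}" and e: "e \<in> U"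
  shows "self_scaled_barrier (range P) (P ` K) (\<lambda>y. F (y + (e - P e)))"
proof -
  note Ps = P_simps[OF P]
  define V where "V = range P"
  define a where "a = e - P e"
  define f where "f y = F (y + a)" for y
  define W where "W = int_in V (P ` K)"
  have W: "W = P ` U" unfolding W_def V_def by (rule int_in_range[OF K_props(2,3,5) P])
  have sub: "subspace V" unfolding V_def using linear_P[OF P] by (simp add: linear_subspace_image)
  have PV: "P v = v" if "v \<in> V" for v using that Ps(6) by (auto simp: V_def)
  have WV: "W \<subseteq> V" using W by (auto simp: V_def)
  have oW: "openin (top_of_set V) W" unfolding W_def by (rule openin_int_in)
  have shift: "y + a \<in> U" if "y \<in> W" for y
    using that exchange_U[OF P _ e] unfolding W a_def by auto
  have Py: "P (y + a) = y" "(y + a) - P (y + a) = a" if "y \<in> V" for y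
    using PV[OF that] by (simp_all add: a_def Ps)
  have f: "f = (\<lambda>y. F (y + a))" by (simp add: f_def fun_eq_iff)
  have fD1: "D1 W f x h = DF (x + a) h" if "x \<in> W" "h \<in> V" for x h
    unfolding f by (rule D1_translate[OF sub oW that open_interior shift[OF that(1)] differentiable(1)])
  have fD2: "D2 W f x h k = H (x + a) h k" if "x \<in> W" "h \<in> V" "k \<in> V" for x h k
    unfolding f by (rule D2_D3_translate(1)[OF sub oW open_interior shift smooth that(1,2,3,3)])
  have fD3: "D3 W f x h k l = D3 U F (x + a) h k l" if "x \<in> W" "h \<in> V" "k \<in> V" "l \<in> V" for x h k l
    unfolding f by (rule D2_D3_translate(2)[OF sub oW open_interior shift smooth that])
  have Hw: "H w x p = H w (P x) p" if "w \<in> U" "p \<in> V" for w x p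
    using H_blocks[OF P that(1), of x p] PV[OF that(2)] H_simps[OF that(1)] by simp
  have hV: "hessian V W f x u \<in> V" and hess: "hessian V W f x u \<bullet> v = H (x + a) u v"
    if "x \<in> W" "u \<in> V" "v \<in> V" for x u v
    using hessian_inner[OF sub linear_H[OF shift[OF that(1)]] fD2[OF that(1,2)]] that(3) by auto
  have "self_concordant_barrier V (P ` K) f"
    unfolding self_concordant_barrier_def W_def[symmetric] Let_def
  proof (intro conjI)
    show "Ck_on 3 V W f"
      unfolding f by (rule Ck_on_translate[OF sub oW open_interior shift smooth])
    have cW: "convex W"
      unfolding W by (rule convex_linear_image[OF linear_P[OF P] convex_U])
    show "convex_on W f"
    proof (rule convex_onI[OF _ cW])
      fix t x y assume t: "0 < (t::real)" "t < 1" and xy: "x \<in> W" "y \<in> W"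
      have "(1 - t) *\<^sub>R x + t *\<^sub>R y + a = (1 - t) *\<^sub>R (x + a) + t *\<^sub>R (y + a)"
        by (simp add: algebra_simps)
      then show "f ((1 - t) *\<^sub>R x + t *\<^sub>R y) \<le> (1 - t) * f x + t * f y"
        unfolding f_def using convex_onD[OF convex_F, of t "x + a" "y + a"] shift xy t by simp
    qed
    show "\<forall>X p. (\<forall>n. X n \<in> W) \<and> X \<longlonglongrightarrow> p \<and> p \<in> top_of_set V frontier_of (P ` K) \<longrightarrow>
        filterlim (\<lambda>n. f (X n)) at_top sequentially"
    proof (intro allI impI, elim conjE)
      fix X p assume X: "\<forall>n. X n \<in> W" "X \<longlonglongrightarrow> p" and p: "p \<in> top_of_set V frontier_of (P ` K)"
      have "closedin (top_of_set V) (P ` K)"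
        unfolding splits_image[OF P] V_def using closedin_closed_Int[OF K_props(1), of "range P"]
        by (simp add: Int_commute)
      then have pK: "p \<in> P ` K" and pW: "p \<notin> W"
        using p by (auto simp: frontier_of_def W_def int_in_def closure_of_closedin)
      have pV: "p \<in> V" using pK by (auto simp: V_def)
      have "a \<in> K" unfolding a_def using P_K(2)[OF P] e interior_subset by blast
      moreover have "p \<in> K" using pK P_K(1)[OF P] by auto
      ultimately have K: "p + a \<in> K" using convex_cone_add K_props by blast
      have "p + a \<notin> U" using pW Py(1)[OF pV] unfolding W by (metis imageI)
      moreover have "(\<lambda>n. X n + a) \<longlonglongrightarrow> p + a" using X(2) by (intro tendsto_intros)
      ultimately show "filterlim (\<lambda>n. f (X n)) at_top sequentially"
        unfolding f_def using blows_up[of "\<lambda>n. X n + a" "p + a"] shift X(1) K by blast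
    qed
    show "\<forall>x\<in>W. \<forall>h\<in>V. \<bar>D3 W f x h h h\<bar> \<le> 2 * D2 W f x h h powr (3 / 2)"
      using fD2 fD3 D3_bound shift by simp
    obtain \<nu>' where "\<forall>x\<in>U. \<forall>h. \<bar>DF x h\<bar>\<^sup>2 \<le> \<nu>' * H x h h" using D1_bound by blast
    then show "\<exists>\<nu>. \<forall>x\<in>W. \<forall>h\<in>V. \<bar>D1 W f x h\<bar>\<^sup>2 \<le> \<nu> * D2 W f x h h"
      using fD1 fD2 shift by (intro exI[of _ \<nu>']) simp
  qed
  moreover have "bij_betw (hessian V W f x) V V" if x: "x \<in> W" for x
  proof -
    \<comment> \<open>the Hessian of \<open>f\<close> is determined only on \<open>V\<close>; this is a linear map of the whole space that agrees
      with it there\<close>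
    let ?T = "hessian V U F (x + a)"
    note TV = hessian_inner(1)[OF sub linear_H[OF shift[OF x]] refl]
    note T = hessian_inner(2)[OF sub linear_H[OF shift[OF x]] refl]
    have eq: "u = v" if "u \<in> V" "v \<in> V" "\<And>p. p \<in> V \<Longrightarrow> u \<bullet> p = v \<bullet> p" for u v
    proof -
      have "(u - v) \<bullet> (u - v) = 0"
        using that(3)[OF subspace_diff[OF sub that(1,2)]] by (simp add: inner_diff_left)
      then show ?thesis by simp
    qed
    have lT: "linear ?T"
    proof (rule linearI)
      show "?T (h + k) = ?T h + ?T k" for h k
        by (rule eq) (simp_all add: TV T subspace_add[OF sub] inner_add_left H_simps[OF shift[OF x]])
      show "?T (r *\<^sub>R h) = r *\<^sub>R ?T h" for r h
        by (rule eq) (simp_all add: TV T subspace_scale[OF sub] H_simps[OF shift[OF x]])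
    qed
    have inj: "inj_on ?T V"
      unfolding linear_inj_on_iff_eq_0[OF lT sub]
    proof (intro ballI impI)
      fix u assume u: "u \<in> V" and "?T u = 0"
      then have "H (x + a) u p = 0" if "p \<in> V" for p using T[OF that, of u] by simp
      then have "H (x + a) u k = 0" for k
        using H_blocks[OF P shift[OF x], of u k] PV[OF u] H_simps[OF shift[OF x]]
        by (simp add: V_def)
      then have "u \<in> K" "- u \<in> K"
        unfolding H_dual[OF shift[OF x], of u] H_dual[OF shift[OF x], of "- u"]
        using H_simps[OF shift[OF x]] by simp_all
      then show "u = 0" using pointed_no_line K_props by blast
    qed
    have "dim (?T ` V) = dim V"
      using inj by (intro dim_image_eq[OF lT]) (simp add: span_eq_iff[THEN iffD2, OF sub])
    then have "?T ` V = V"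
      using TV by (intro subspace_dim_equal) (auto simp: sub linear_subspace_image[OF lT])
    then have "bij_betw ?T V V" using inj by (simp add: bij_betw_def)
    moreover have "?T u = hessian V W f x u" if u: "u \<in> V" for u
      by (rule eq) (simp_all add: TV T hV[OF x u u] hess[OF x u])
    ultimately show ?thesis using bij_betw_cong[of V ?T "hessian V W f x"] by blast
  qed
  moreover have "f (t *\<^sub>R x) = f x - deg P * ln t" if "x \<in> W" "t > 0" for x t
    using F_partial_scale[OF P shift[OF that(1)] that(2)] Py WV that(1) by (auto simp: f_def)
  moreover have "hessian V W f w x \<in> int_in V (dual_cone V (\<bullet>) (P ` K))"
    if x: "x \<in> W" and w: "w \<in> W" for x w
  proof -
    have xV: "x \<in> V" using x WV by blast
    let ?G = "hessian UNIV U F (w + a) (x + a)" and ?s = "hessian V W f w x"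
    obtain \<epsilon> where \<epsilon>: "\<epsilon> > 0" "ball ?G \<epsilon> \<subseteq> dual_cone UNIV (\<bullet>) K"
      using scaled_dual[OF shift[OF x] shift[OF w]] mem_interior by blast
    have "s \<in> dual_cone V (\<bullet>) (P ` K)" if s: "s \<in> V" "dist s ?s < \<epsilon>" for s
      unfolding dual_cone_def
    proof (intro CollectI conjI ballI s(1))
      fix p assume p: "p \<in> P ` K"
      then have pV: "p \<in> V" and pK: "p \<in> K" using P_K(1)[OF P] by (auto simp: V_def)
      have "?G + (s - ?s) \<in> ball ?G \<epsilon>" using s(2) by (simp add: dist_norm norm_minus_commute)
      then have "0 \<le> p \<bullet> (?G + (s - ?s))" using \<epsilon>(2) pK by (auto simp: dual_cone_def)
      moreover have "p \<bullet> ?G = p \<bullet> ?s"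
        using hessian_H[OF shift[OF w], of "x + a" p] hess[OF w xV pV]
          Hw[OF shift[OF w] pV, of "x + a"] Py(1)[OF xV]
        by (simp add: inner_commute)
      ultimately show "0 \<le> p \<bullet> s" by (simp add: inner_add_right inner_diff_right)
    qed
    then show ?thesis
      using \<epsilon>(1) hV[OF w xV xV] by (subst int_in_iff[OF sub]) (auto simp: dual_cone_def)
  qed
  moreover have "conjugate_barrier V (P ` K) f (hessian V W f w x) = ereal (f x - 2 * f w - deg P)"
    if x: "x \<in> W" and w: "w \<in> W" for x w
  proof -
    have xV: "x \<in> V" and wV: "w \<in> V" using x w WV by auto
    have "conjugate_barrier V (P ` K) f (hessian V W f w x) =
        (SUP p\<in>P ` U. ereal (- H (w + a) x p - F (p + a)))"
      unfolding conjugate_barrier_def W_def[symmetric] W[symmetric]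
      using hess[OF w xV] WV by (intro SUP_cong) (auto simp: f_def inner_commute)
    then show ?thesis
      using partial_conjugate[OF P shift[OF w] shift[OF x]] Py[OF xV] Py[OF wV]
      by (simp add: f_def)
  qed
  ultimately show ?thesis
    unfolding self_scaled_barrier_def a_def[symmetric] f[symmetric] V_def[symmetric]
      W_def[symmetric] Let_def
    using deg_pos[OF P nz] by blast
qed

text \<open>
  The blocks of \<open>e\<close> are replaced by those of \<open>x\<close> one after the other, each replacement being an instance of
  \<open>F_exchange\<close>. Because \<open>F e = 0\<close>, no constant has to be distributed among the summands.
\<close>
lemma F_sum_blocks:
  assumes P: "\<And>i. i \<in> J \<Longrightarrow> splits (P i) K" and "finite J"
    and disj: "\<And>i j x. i \<in> J \<Longrightarrow> j \<in> J \<Longrightarrow> i \<noteq> j \<Longrightarrow> P i (P j x) = 0"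
    and x: "x \<in> U" and e: "e \<in> U" and F0: "F e = 0"
  shows "(\<Sum>i\<in>J. P i x) + (e - (\<Sum>i\<in>J. P i e)) \<in> U \<and>
    F ((\<Sum>i\<in>J. P i x) + (e - (\<Sum>i\<in>J. P i e))) = (\<Sum>i\<in>J. F (P i x + (e - P i e)))"
  using assms(2,1,3)
proof (induction J)
  case empty
  then show ?case using e F0 by simp
next
  case (insert i J)
  let ?z = "\<lambda>J. (\<Sum>i\<in>J. P i x) + (e - (\<Sum>i\<in>J. P i e))"
  have Pi: "splits (P i) K" using insert.prems(1) by simp
  note Ps = P_simps[OF Pi]
  have IH: "?z J \<in> U" "F (?z J) = (\<Sum>i\<in>J. F (P i x + (e - P i e)))"
    using insert.IH insert.prems by auto
  have "P i (\<Sum>j\<in>J. P j y) = 0" for y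
    using insert.hyps(2) insert.prems(2) by (subst linear_sum[OF linear_P[OF Pi]]) (auto intro!: sum.neutral)
  then have Pz: "P i (?z J) = P i e" by (simp add: Ps)
  have z: "?z (insert i J) = P i x + (?z J - P i (?z J))"
    unfolding Pz using insert.hyps by (simp add: algebra_simps)
  have zU: "?z (insert i J) \<in> U" unfolding z by (rule exchange_U[OF Pi x IH(1)])
  have Piz: "P i (?z (insert i J)) = P i x" unfolding z by (simp add: Ps)
  have "F (?z (insert i J)) + F e =
      F (P i x + (e - P i e)) + F (P i e + (?z (insert i J) - P i x))"
    using F_exchange[OF Pi zU e] unfolding Piz .
  also have "P i e + (?z (insert i J) - P i x) = ?z J"
    unfolding z Pz by simp
  finally show ?case using zU IH(2) F0 insert.hyps by simp
qed

end

section \<open>Components of a decomposition\<close>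

lemma direct_sum_projections:
  fixes E :: "nat \<Rightarrow> 'a::euclidean_space set"
  assumes "direct_sum UNIV m E"
  obtains P where "\<And>i. i \<in> {1..m} \<Longrightarrow> linear (P i)" and "\<And>i. i \<in> {1..m} \<Longrightarrow> range (P i) = E i"
    and "\<And>x. (\<Sum>i\<in>{1..m}. P i x) = x"
    and "\<And>i j x. i \<in> {1..m} \<Longrightarrow> j \<in> {1..m} \<Longrightarrow> x \<in> E i \<Longrightarrow> P j x = (if j = i then x else 0)"
proof -
  let ?I = "{1..m}"
  have sub: "subspace (E i)" if "i \<in> ?I" for i using assms that by (simp add: direct_sum_def)
  have "\<exists>s. (\<forall>i\<in>?I. s i \<in> E i) \<and> x = sum s ?I" for x
  proof -
    have "x \<in> (\<Sum>i\<in>?I. E i)" using assms unfolding direct_sum_def by blast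
    then show ?thesis unfolding set_sum_alt[OF finite_atLeastAtMost] by blast
  qed
  then obtain c where c: "\<And>x i. i \<in> ?I \<Longrightarrow> c x i \<in> E i" and cs: "\<And>x. x = sum (c x) ?I" by metis
  have uniq: "c x i = s i" if s: "\<And>i. i \<in> ?I \<Longrightarrow> s i \<in> E i" "sum s ?I = x" and i: "i \<in> ?I" for x s i
  proof -
    have "\<forall>i\<in>?I. c x i - s i \<in> E i" using c s sub subspace_diff by blast
    moreover have "(\<Sum>i\<in>?I. c x i - s i) = 0" using s(2) cs[of x] by (simp add: sum_subtractf)
    ultimately have "\<forall>i\<in>?I. c x i - s i = 0"
      using assms unfolding direct_sum_def by (elim conjE allE[of _ "\<lambda>i. c x i - s i"]) blast
    then show ?thesis using i by simp
  qed
  have c_fixed: "c x j = (if j = i then x else 0)" if "i \<in> ?I" "j \<in> ?I" "x \<in> E i" for i j x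
    using that by (intro uniq) (auto simp: subspace_0[OF sub])
  show ?thesis
  proof
    show "linear (\<lambda>x. c x i)" if i: "i \<in> ?I" for i
    proof (rule linearI)
      show "c (x + y) i = c x i + c y i" for x y
        using i c cs subspace_add[OF sub]
        by (intro uniq[of "\<lambda>i. c x i + c y i"]) (simp_all add: sum.distrib flip: cs)
      show "c (r *\<^sub>R x) i = r *\<^sub>R c x i" for r x
        using i c cs subspace_scale[OF sub]
        by (intro uniq[of "\<lambda>i. r *\<^sub>R c x i"]) (simp_all flip: cs scaleR_right.sum)
    qed
    show "range (\<lambda>x. c x i) = E i" if i: "i \<in> ?I" for i
    proof
      show "range (\<lambda>x. c x i) \<subseteq> E i" using c i by blast
      show "E i \<subseteq> range (\<lambda>x. c x i)"
      proof
        fix x assume "x \<in> E i"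
        then have "x = c x i" using c_fixed i by simp
        then show "x \<in> range (\<lambda>x. c x i)" by blast
      qed
    qed
    show "(\<Sum>i\<in>?I. c x i) = x" for x using cs[of x] by simp
    show "c x j = (if j = i then x else 0)" if "i \<in> ?I" "j \<in> ?I" "x \<in> E i" for i j x
      using c_fixed that by blast
  qed
qed

text \<open>
  A direct decomposition of \<open>K\<close> with non-zero summands, given by its family of coordinate projections.
\<close>
locale cone_components =
  fixes K :: "'a::euclidean_space set" and I :: "nat set" and P :: "nat \<Rightarrow> 'a \<Rightarrow> 'a"
  assumes fin: "finite I"
    and split: "\<And>i. i \<in> I \<Longrightarrow> splits (P i) K"
    and sum_P: "\<And>x. (\<Sum>i\<in>I. P i x) = x"
    and disjoint: "\<And>i j x. i \<in> I \<Longrightarrow> j \<in> I \<Longrightarrow> i \<noteq> j \<Longrightarrow> P i (P j x) = 0"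
    and nonzero: "\<And>i. i \<in> I \<Longrightarrow> range (P i) \<noteq> {0}"

lemma cone_decomposition_components:
  assumes K: "convex K" "cone K" "interior K \<noteq> {}" and dec: "cone_decomposition UNIV K m E Ks"
  obtains P where "cone_components K {1..m} P"
    and "\<And>i. i \<in> {1..m} \<Longrightarrow> range (P i) = E i"
    and "\<And>i. i \<in> {1..m} \<Longrightarrow> P i ` K = Ks i"
proof -
  let ?I = "{1..m}"
  from dec have ds: "direct_sum UNIV m E" and nz: "\<And>i. i \<in> ?I \<Longrightarrow> E i \<noteq> {0}"
    and Ks: "\<And>i. i \<in> ?I \<Longrightarrow> cone (Ks i)" "\<And>i. i \<in> ?I \<Longrightarrow> Ks i \<subseteq> E i"
    and sumK: "K = (\<Sum>i\<in>?I. Ks i)"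
    by (auto simp: cone_decomposition_def)
  obtain P where P: "\<And>i. i \<in> ?I \<Longrightarrow> linear (P i)" "\<And>i. i \<in> ?I \<Longrightarrow> range (P i) = E i"
    "\<And>x. (\<Sum>i\<in>?I. P i x) = x"
    "\<And>i j x. i \<in> ?I \<Longrightarrow> j \<in> ?I \<Longrightarrow> x \<in> E i \<Longrightarrow> P j x = (if j = i then x else 0)"
    by (rule direct_sum_projections[OF ds], rule that)
  have K_iff: "x \<in> K \<longleftrightarrow> (\<exists>s. (\<forall>i\<in>?I. s i \<in> Ks i) \<and> x = sum s ?I)" for x
    unfolding sumK using set_sum_alt[of ?I Ks] by auto
  have Psum: "P j (sum s ?I) = s j" if "j \<in> ?I" "\<And>i. i \<in> ?I \<Longrightarrow> s i \<in> E i" for s j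
  proof -
    have "P j (sum s ?I) = (\<Sum>i\<in>?I. P j (s i))" by (rule linear_sum[OF P(1)[OF that(1)]])
    also have "\<dots> = (\<Sum>i\<in>?I. if j = i then s i else 0)" using that P(4) by (intro sum.cong) auto
    also have "\<dots> = s j" using that(1) by simp
    finally show ?thesis .
  qed
  have PK: "P j x \<in> Ks j" if j: "j \<in> ?I" and x: "x \<in> K" for j x
  proof -
    obtain s where "\<forall>i\<in>?I. s i \<in> Ks i" "x = sum s ?I" using x K_iff by blast
    moreover from this(1) have "\<And>i. i \<in> ?I \<Longrightarrow> s i \<in> E i" using Ks(2) by blast
    ultimately show ?thesis using Psum[OF j, of s] j by simp
  qed
  have "K \<noteq> {}" using K(3) interior_subset by blast
  then have zero: "0 \<in> Ks i" if "i \<in> ?I" for i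
    using PK[OF that] Ks(1)[OF that] cone_0 by (metis all_not_in_conv cone_contains_0)
  have KsK: "Ks j \<subseteq> K" if "j \<in> ?I" for j
  proof
    fix x assume "x \<in> Ks j"
    then have "(\<forall>i\<in>?I. (if i = j then x else 0) \<in> Ks i) \<and> x = (\<Sum>i\<in>?I. if i = j then x else 0)"
      using zero that by auto
    then show "x \<in> K" unfolding K_iff by (intro exI[of _ "\<lambda>i. if i = j then x else 0"]) simp
  qed
  have rest: "x - P j x \<in> K" if "j \<in> ?I" "x \<in> K" for j x
  proof -
    have "x = (\<Sum>i\<in>?I. P i x)" using P(3) by simp
    then have "x - P j x = (\<Sum>i\<in>?I. P i x) - P j x" by simp
    also have "\<dots> = (\<Sum>i\<in>?I. if i = j then 0 else P i x)"
    proof -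
      have "(\<Sum>i\<in>?I. if i = j then 0 else P i x) + (\<Sum>i\<in>?I. if i = j then P i x else 0) = (\<Sum>i\<in>?I. P i x)"
        unfolding sum.distrib[symmetric] by (intro sum.cong) auto
      moreover have "(\<Sum>i\<in>?I. if i = j then P i x else 0) = P j x" using that(1) by simp
      ultimately show ?thesis by (simp add: algebra_simps)
    qed
    finally show ?thesis
      unfolding K_iff using PK that zero
      by (intro exI[of _ "\<lambda>i. if i = j then 0 else P i x"]) auto
  qed
  have inE: "P i x \<in> E i" if "i \<in> ?I" for i x using P(2)[OF that] by blast
  show ?thesis
  proof
    show "cone_components K ?I P"
    proof
      show "splits (P i) K" if "i \<in> ?I" for i
        unfolding splits_def using P(1)[OF that] P(4)[OF that that inE[OF that]] PK[OF that] KsK[OF that]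
          rest[OF that] by auto
      show "P i (P j x) = 0" if "i \<in> ?I" "j \<in> ?I" "i \<noteq> j" for i j x
        using P(4)[OF that(2,1) inE[OF that(2)]] that(3) by simp
      show "range (P i) \<noteq> {0}" if "i \<in> ?I" for i using P(2) nz that by simp
    qed (use P(3) in auto)
    show "range (P i) = E i" if "i \<in> ?I" for i using P(2) that .
    show "P i ` K = Ks i" if i: "i \<in> ?I" for i
    proof
      show "P i ` K \<subseteq> Ks i" using PK[OF i] by blast
      show "Ks i \<subseteq> P i ` K"
      proof
        fix x assume x: "x \<in> Ks i"
        then have "x = P i x" using P(4)[OF i i] Ks(2)[OF i] by auto
        then show "x \<in> P i ` K" using KsK[OF i] x by blast
      qed
    qed
  qed
qed

lemma regular_cone_block:
  assumes K: "regular_cone UNIV K" and P: "splits P K"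
  shows "regular_cone (range P) (P ` K)"
proof -
  have Kp: "closed K" "convex K" "cone K" "pointed K" "interior K \<noteq> {}"
    using K by (auto simp: regular_cone_def int_in_UNIV)
  have lP: "linear P" using P by (simp add: splits_def)
  then have sub: "subspace (range P)" by (simp add: linear_subspace_image)
  have im: "P ` K = K \<inter> range P" by (rule splits_image[OF P])
  have "cone (P ` K)" using Kp(3) sub unfolding im cone_def by (auto intro: subspace_scale)
  moreover have "closed (P ` K)" unfolding im by (intro closed_Int Kp(1) closed_subspace sub)
  moreover have "convex (P ` K)" by (rule convex_linear_image[OF lP Kp(2)])
  moreover have "pointed (P ` K)" using Kp(4) unfolding im pointed_def by blast
  ultimately show ?thesis
    unfolding regular_cone_def using sub int_in_range[OF Kp(2,3,5) P] Kp(5) by auto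
qed

text \<open>
  The components are orthogonal for an inner product \<open>B\<close> under which \<open>K\<close> is self-dual, so testing a vector of
  one component against \<open>K\<close> is testing it against that component.
\<close>
lemma self_dual_block:
  assumes K: "regular_cone UNIV K" and P: "splits P K"
    and B: "inner_product_on UNIV B" and dual: "dual_cone UNIV B K = K"
  shows "inner_product_on (range P) B \<and> dual_cone (range P) B (P ` K) = P ` K"
proof
  have Kp: "convex K" "cone K" "pointed K" "interior K \<noteq> {}"
    using K by (auto simp: regular_cone_def int_in_UNIV)
  have idem: "P (P x) = P x" for x using P by (simp add: splits_def)
  show "inner_product_on (range P) B" using B unfolding inner_product_on_def by blast
  have sym: "B x y = B y x" and add: "B (x + y) z = B x z + B y z" and sc: "B (c *\<^sub>R x) y = c * B x y"
    and pos: "x \<noteq> 0 \<Longrightarrow> B x x > 0" for x y z c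
    using B by (auto simp: inner_product_on_def)
  have addr: "B z (x + y) = B z x + B z y" for x y z using add[of x y z] by (simp add: sym[of z])
  have scr: "B y (c *\<^sub>R x) = c * B y x" for x y c using sc sym by metis
  have bl: "bilinear B"
    unfolding bilinear_def
    by (intro conjI allI linearI) (simp_all add: add addr sc scr)
  have Kd: "s \<in> K \<longleftrightarrow> (\<forall>x\<in>K. B s x \<ge> 0)" for s
    using dual sym by (auto simp: dual_cone_def set_eq_iff)
  have cross: "B (P h) (k - P k) = 0" for h k
    by (rule splits_orthogonal[OF Kp P bl Kd]) (use pos in force)
  have PK: "P ` K = K \<inter> range P" by (rule splits_image[OF P])
  show "dual_cone (range P) B (P ` K) = P ` K"
  proof (intro set_eqI iffI)
    fix s assume s: "s \<in> dual_cone (range P) B (P ` K)"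
    then have sP: "s = P s" "s \<in> range P" by (auto simp: dual_cone_def idem)
    have "B s x \<ge> 0" if "x \<in> K" for x
    proof -
      have "B s x = B s (P x + (x - P x))" by simp
      also have "\<dots> = B s (P x)" unfolding addr using cross[of s x] sP(1) by simp
      also have "\<dots> \<ge> 0" using s that sym by (auto simp: dual_cone_def)
      finally show ?thesis .
    qed
    then show "s \<in> P ` K" unfolding PK using Kd sP(2) by blast
  next
    fix s assume "s \<in> P ` K"
    then show "s \<in> dual_cone (range P) B (P ` K)"
      unfolding PK using Kd[of s] sym by (auto simp: dual_cone_def)
  qed
qed

text \<open>
  The block of \<open>K\<close> is a face, so a second splitting \<open>R\<close> of \<open>K\<close> maps it into itself and splits it. By
  irreducibility one of the two halves is trivial.
\<close>
lemma irreducible_block: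
  assumes K: "regular_cone UNIV K" and P: "splits P K" and R: "splits R K"
    and irr: "irreducible_cone (range P) (P ` K)"
  shows "(\<forall>x\<in>range P. R x = 0) \<or> (\<forall>x\<in>range P. R x = x)"
proof (rule ccontr)
  assume contra: "\<not> ?thesis"
  have Kp: "convex K" "cone K" "pointed K" "interior K \<noteq> {}"
    using K by (auto simp: regular_cone_def int_in_UNIV)
  define V where "V = range P"
  define C where "C = P ` K"
  have lP: "linear P" and lR: "linear R" and idem: "P (P x) = P x" "R (R x) = R x" for x
    using P R by (auto simp: splits_def)
  have lQ: "linear (\<lambda>x. x - R x)" using splits_compl[OF R] by (simp add: splits_def)
  note Rs = linear_add[OF lR] linear_diff[OF lR] idem(2)
  have C: "C = K \<inter> V" unfolding C_def V_def by (rule splits_image[OF P])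
  have sub: "subspace V" unfolding V_def using lP by (simp add: linear_subspace_image)
  have "span K = UNIV"
    using affine_hull_nonempty_interior[OF Kp(4)] affine_hull_subset_span[of K] by auto
  then have spanC: "span C = V"
    unfolding C_def V_def using linear_span_image[OF lP, of K] by simp
  have RC: "R x \<in> C" "x - R x \<in> C" if "x \<in> C" for x
  proof -
    have K: "R x \<in> K" "x - R x \<in> K" using R that by (auto simp: C splits_def)
    moreover have "(R x + (x - R x)) - P (R x + (x - R x)) = 0"
      using that idem by (auto simp: C V_def)
    ultimately have "R x - P (R x) = 0" "(x - R x) - P (x - R x) = 0"
      using splits_face[OF Kp(2,3) splits_compl[OF P]] by blast+
    then have "R x = P (R x)" "x - R x = P (x - R x)" by simp_all
    then show "R x \<in> C" "x - R x \<in> C" using K unfolding C V_def by (metis IntI rangeI)+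
  qed
  have "R ` V \<subseteq> V"
    using RC(1) spanC linear_span_image[OF lR, of C] span_mono[of "R ` C" C] by blast
  then have RV: "R x \<in> V" "x - R x \<in> V" if "x \<in> V" for x
    using that subspace_diff[OF sub] by blast+
  define E where "E i = (if i = 1 then R ` V else (\<lambda>x. x - R x) ` V)" for i :: nat
  define Ks where "Ks i = (if i = 1 then R ` C else (\<lambda>x. x - R x) ` C)" for i :: nat
  have I2: "{1..2} = {1, 2::nat}" by auto
  have sums: "(\<Sum>i\<in>{1..2}. g i) = g 1 + g 2" for g :: "nat \<Rightarrow> 'b::comm_monoid_add"
    by (simp add: I2)
  have coneC: "cone C" and addC: "\<And>x y. x \<in> C \<Longrightarrow> y \<in> C \<Longrightarrow> x + y \<in> C"
    using Kp(2) sub convex_cone_add[OF Kp(1,2)] unfolding C cone_def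
    by (auto intro: subspace_scale subspace_add)
  have "direct_sum V 2 E"
    unfolding direct_sum_def
  proof (intro conjI ballI allI impI)
    show "subspace (E i)" if "i \<in> {1..2}" for i
      using linear_subspace_image[OF lR sub] linear_subspace_image[OF lQ sub] by (simp add: E_def)
    show "V = (\<Sum>i\<in>{1..2}. E i)"
      unfolding sums
    proof (intro set_eqI iffI)
      fix x assume "x \<in> V"
      then have "R x + (x - R x) \<in> E 1 + E 2" by (intro set_plus_intro) (auto simp: E_def)
      then show "x \<in> E 1 + E 2" by simp
    next
      fix x assume "x \<in> E 1 + E 2"
      then show "x \<in> V" using RV subspace_add[OF sub] by (auto simp: E_def set_plus_def)
    qed
    fix x :: "nat \<Rightarrow> 'a" and i :: nat
    assume x: "(\<forall>i\<in>{1..2}. x i \<in> E i) \<and> (\<Sum>i\<in>{1..2}. x i) = 0" and i: "i \<in> {1..2}"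
    then have "x 1 \<in> E 1" "x 2 \<in> E 2" and s: "x 1 + x 2 = 0" by (auto simp: sums)
    then have "R (x 1) = x 1" "R (x 2) = 0" by (auto simp: E_def Rs)
    then have "x 1 = R (x 1 + x 2)" using Rs(1) by simp
    then have "x 1 = 0" using s linear_0[OF lR] by simp
    then show "x i = 0" using s i I2 by auto
  qed
  moreover have "E i \<noteq> {0}" if "i \<in> {1..2}" for i
  proof -
    obtain u where "u \<in> V" "R u \<noteq> 0" using contra unfolding V_def by blast
    moreover obtain v where "v \<in> V" "v \<noteq> R v" using contra unfolding V_def by force
    ultimately have "i = 1 \<Longrightarrow> R u \<in> E i" "i \<noteq> 1 \<Longrightarrow> v - R v \<in> E i" "v - R v \<noteq> 0"
      by (simp_all add: E_def)
    then show ?thesis using \<open>R u \<noteq> 0\<close> by blast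
  qed
  moreover have "cone (Ks i) \<and> Ks i \<subseteq> E i" if "i \<in> {1..2}" for i
  proof
    show "Ks i \<subseteq> E i" by (auto simp: Ks_def E_def C)
    have "cone (g ` C)" if g: "linear g" for g :: "'a \<Rightarrow> 'a"
      using coneC unfolding cone_def by (auto simp flip: linear_scale[OF g])
    then show "cone (Ks i)" using lR lQ by (simp add: Ks_def)
  qed
  moreover have "C = (\<Sum>i\<in>{1..2}. Ks i)"
    unfolding sums
  proof (intro set_eqI iffI)
    fix x assume "x \<in> C"
    then have "R x + (x - R x) \<in> Ks 1 + Ks 2" by (intro set_plus_intro) (auto simp: Ks_def)
    then show "x \<in> Ks 1 + Ks 2" by simp
  next
    fix x assume "x \<in> Ks 1 + Ks 2"
    then show "x \<in> C" using RC addC by (auto simp: Ks_def set_plus_def)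
  qed
  ultimately have "cone_decomposition V C 2 E Ks" unfolding cone_decomposition_def by blast
  then show False using irr unfolding irreducible_cone_def V_def C_def by auto
qed

lemma cone_aut_inverse:
  assumes A: "A \<in> cone_aut UNIV K"
  obtains B where "B \<in> cone_aut UNIV K" "\<And>x. B (A x) = x" "\<And>x. A (B x) = x"
proof -
  have lA: "linear A" and bA: "bij A" and AK: "A ` K = K" using A by (auto simp: cone_aut_def)
  define B where "B = inv A"
  have BA: "B (A x) = x" and AB: "A (B x) = x" for x
    using bA by (simp_all add: B_def bij_is_inj bij_is_surj surj_f_inv_f)
  have "linear B"
    by (rule linearI; rule injD[OF bij_is_inj[OF bA]])
      (simp_all add: AB linear_add[OF lA] linear_scale[OF lA])
  moreover have "B ` (A ` K) = K" unfolding image_image BA by simp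
  then have "B ` K = K" unfolding AK .
  moreover have "bij B" unfolding B_def using bA by (rule bij_imp_bij_inv)
  ultimately have "B \<in> cone_aut UNIV K" by (simp add: cone_aut_def)
  then show ?thesis using that BA AB by blast
qed

context cone_components
begin

lemma block_fixed: "i \<in> I \<Longrightarrow> x \<in> range (P i) \<Longrightarrow> P i x = x"
  using split by (auto simp: splits_def)

lemma block_disjoint: "i \<in> I \<Longrightarrow> j \<in> I \<Longrightarrow> i \<noteq> j \<Longrightarrow> x \<in> range (P j) \<Longrightarrow> P i x = 0"
  using disjoint by auto

lemma block_shift:
  assumes i: "i \<in> I" and x: "x \<in> range (P i)"
  shows "P i (x + (e - P i e)) = x"
    and "j \<in> I \<Longrightarrow> j \<noteq> i \<Longrightarrow> P j (x + (e - P i e)) = P j e"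
proof -
  have lP: "linear (P j)" if "j \<in> I" for j using split[OF that] by (simp add: splits_def)
  show "P i (x + (e - P i e)) = x"
    unfolding linear_add[OF lP[OF i]] linear_diff[OF lP[OF i]]
    using block_fixed[OF i x] block_fixed[OF i rangeI, of e] by simp
  show "P j (x + (e - P i e)) = P j e" if j: "j \<in> I" "j \<noteq> i"
    unfolding linear_add[OF lP[OF j(1)]] linear_diff[OF lP[OF j(1)]]
    using block_disjoint[OF j(1) i j(2) x] disjoint[OF j(1) i j(2), of e] by simp
qed

lemma block_unique:
  assumes "i \<in> I" "j \<in> I" "range (P i) \<subseteq> range (P j)"
  shows "i = j"
proof (rule ccontr)
  assume "i \<noteq> j"
  have "P i x = 0" for x
  proof -
    have "P i x = P i (P i x)" using block_fixed[OF assms(1) rangeI] by simp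
    also have "\<dots> = 0" using block_disjoint[OF assms(1,2) \<open>i \<noteq> j\<close>] assms(3) by blast
    finally show ?thesis .
  qed
  then have "range (P i) = {0}" by auto
  then show False using nonzero assms(1) by simp
qed

text \<open>
  Pulling the coordinate projections back along \<open>A\<close> gives splittings of \<open>K\<close>, each of which is \<open>0\<close> or the
  identity on a given irreducible component; not all are \<open>0\<close>, so \<open>A\<close> maps the component into another
  one. The same for the inverse of \<open>A\<close> shows that it is mapped onto. The permutation is made total, by
  the identity outside \<open>I\<close>, in order to be iterated.
\<close>
lemma cone_aut_permutes:
  assumes K: "regular_cone UNIV K"
    and irr: "\<And>i. i \<in> I \<Longrightarrow> irreducible_cone (range (P i)) (P i ` K)"
    and A: "A \<in> cone_aut UNIV K"
  obtains \<sigma> where "inj \<sigma>" "\<And>i. i \<in> I \<Longrightarrow> \<sigma> i \<in> I"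
    and "\<And>i. i \<in> I \<Longrightarrow> A ` range (P i) = range (P (\<sigma> i))"
proof -
  have ex: "\<exists>j\<in>I. A ` range (P i) \<subseteq> range (P j)" if A: "A \<in> cone_aut UNIV K" and i: "i \<in> I" for A i
  proof (rule ccontr)
    assume none: "\<not> ?thesis"
    obtain B where "B \<in> cone_aut UNIV K" and BA: "\<And>x. B (A x) = x" and AB: "\<And>x. A (B x) = x"
      using cone_aut_inverse[OF A] by blast
    then have lA: "linear A" and lB: "linear B"
      and A_K: "\<And>x. x \<in> K \<Longrightarrow> A x \<in> K" and BK: "\<And>x. x \<in> K \<Longrightarrow> B x \<in> K"
      using A by (auto simp: cone_aut_def)
    have "A x = 0" if x: "x \<in> range (P i)" for x
    proof -
      have "P j (A x) = 0" if j: "j \<in> I" for j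
      proof -
        let ?R = "\<lambda>x. B (P j (A x))"
        have Pj: "linear (P j)" "\<And>x. P j (P j x) = P j x" "\<And>x. x \<in> K \<Longrightarrow> P j x \<in> K"
          "\<And>x. x \<in> K \<Longrightarrow> x - P j x \<in> K"
          using split[OF j] by (auto simp: splits_def)
        have "splits ?R K"
          unfolding splits_def
        proof (intro conjI allI ballI)
          show "linear ?R" using linear_compose[OF linear_compose[OF lA Pj(1)] lB] by (simp add: o_def)
          show "?R (?R x) = ?R x" for x by (simp add: AB Pj(2))
          fix x assume x: "x \<in> K"
          show "?R x \<in> K" using BK Pj(3) A_K x by blast
          have "x - ?R x = B (A x - P j (A x))" by (simp add: linear_diff[OF lB] BA)
          then show "x - ?R x \<in> K" using BK Pj(4) A_K x by metis
        qed
        from irreducible_block[OF K split[OF i] this irr[OF i]]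
        consider "\<forall>x\<in>range (P i). ?R x = 0" | "\<forall>x\<in>range (P i). ?R x = x" by blast
        then show ?thesis
        proof cases
          case 1
          then have "B (P j (A x)) = 0" using x by blast
          then show ?thesis using AB[of "P j (A x)"] linear_0[OF lA] by simp
        next
          case 2
          then have "A y \<in> range (P j)" if "y \<in> range (P i)" for y
            using AB[of "P j (A y)"] that by (metis rangeI)
          then have False using none j by blast
          then show ?thesis ..
        qed
      qed
      then have "(\<Sum>j\<in>I. P j (A x)) = 0" by simp
      then show ?thesis using sum_P by simp
    qed
    then have "P i x = 0" for x using BA[of "P i x"] linear_0[OF lB] by simp
    then have "range (P i) = {0}" by auto
    then show False using nonzero[OF i] by simp
  qed
  have ex_eq: "\<exists>j\<in>I. A ` range (P i) = range (P j)" if i: "i \<in> I" for i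
  proof -
    obtain B where B: "B \<in> cone_aut UNIV K" and BA: "\<And>x. B (A x) = x" and AB: "\<And>x. A (B x) = x"
      using cone_aut_inverse[OF A] by blast
    obtain j where j: "j \<in> I" "A ` range (P i) \<subseteq> range (P j)" using ex[OF A i] by blast
    obtain k where k: "k \<in> I" "B ` range (P j) \<subseteq> range (P k)" using ex[OF B j(1)] by blast
    have BAi: "B ` (A ` range (P i)) = range (P i)" by (simp add: image_image BA)
    then have "range (P i) \<subseteq> range (P k)" using j(2) k(2) by blast
    then have "i = k" by (rule block_unique[OF i k(1)])
    then have "A ` (B ` range (P j)) \<subseteq> A ` range (P i)" using k(2) by blast
    then have "range (P j) \<subseteq> A ` range (P i)" by (simp add: image_image AB)
    then show ?thesis using j by blast
  qed
  then obtain s where s: "\<And>i. i \<in> I \<Longrightarrow> s i \<in> I" "\<And>i. i \<in> I \<Longrightarrow> A ` range (P i) = range (P (s i))"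
    by metis
  define \<sigma> where "\<sigma> i = (if i \<in> I then s i else i)" for i
  show ?thesis
  proof
    show "inj \<sigma>"
    proof (rule injI)
      fix i j assume eq: "\<sigma> i = \<sigma> j"
      show "i = j"
      proof (cases "i \<in> I \<and> j \<in> I")
        case True
        then have "A ` range (P i) = A ` range (P j)" using s(2) eq by (simp add: \<sigma>_def)
        moreover have "inj A" using A by (auto simp: cone_aut_def bij_is_inj)
        ultimately have "range (P i) = range (P j)" by (simp add: inj_image_eq_iff)
        then show ?thesis using block_unique True by blast
      next
        case False
        then show ?thesis using eq s(1) by (auto simp: \<sigma>_def split: if_splits)
      qed
    qed
  qed (use s in \<open>auto simp: \<sigma>_def\<close>)
qed

text \<open>
  Choose \<open>A\<close> with \<open>A (x + q) = y + q\<close>, where \<open>q = e - P i e\<close>, and let \<open>\<sigma>\<close> be its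
  permutation of the components. Comparing coordinates, \<open>A\<close> sends \<open>x\<close> to a coordinate of \<open>q\<close>, that one to the
  coordinate of \<open>q\<close> in the next component, and so on along the cycle of \<open>i\<close>, until the
  cycle closes with \<open>y\<close>. If \<open>n\<close> is its length, \<open>A ^^ n\<close> preserves the component and maps
  \<open>x\<close> to \<open>y\<close>.
\<close>
lemma homogeneous_block:
  assumes K: "regular_cone UNIV K"
    and irr: "\<And>i. i \<in> I \<Longrightarrow> irreducible_cone (range (P i)) (P i ` K)"
    and hom: "\<And>x y. x \<in> interior K \<Longrightarrow> y \<in> interior K \<Longrightarrow> \<exists>A\<in>cone_aut UNIV K. A x = y"
    and i: "i \<in> I" and x: "x \<in> P i ` interior K" and y: "y \<in> P i ` interior K"
  shows "\<exists>A\<in>cone_aut (range (P i)) (P i ` K). A x = y"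
proof -
  have Kp: "convex K" "cone K" "pointed K" "interior K \<noteq> {}"
    using K by (auto simp: regular_cone_def int_in_UNIV)
  have lP: "linear (P j)" if "j \<in> I" for j using split[OF that] by (simp add: splits_def)
  obtain e where e: "e \<in> interior K" using Kp(4) by blast
  define x' y' where "x' = x + (e - P i e)" and "y' = y + (e - P i e)"
  have "x' \<in> interior K" "y' \<in> interior K"
    unfolding x'_def y'_def using x y interior_exchange[OF Kp(1,2) split[OF i] _ e] by auto
  then obtain A where A: "A \<in> cone_aut UNIV K" "A x' = y'" using hom by blast
  then have lA: "linear A" and injA: "inj A" and AK: "A ` K = K"
    by (auto simp: cone_aut_def bij_is_inj)
  have xy: "x \<in> range (P i)" "y \<in> range (P i)" using x y by auto
  have Pi: "P i x' = x" "P i y' = y"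
    unfolding x'_def y'_def using block_shift(1)[OF i] xy by simp_all
  have Pj: "P j x' = P j y'" if "j \<in> I" "j \<noteq> i" for j
    unfolding x'_def y'_def using block_shift(2)[OF i] xy that by simp
  obtain \<sigma> where \<sigma>: "inj \<sigma>" "\<And>i. i \<in> I \<Longrightarrow> \<sigma> i \<in> I"
    "\<And>i. i \<in> I \<Longrightarrow> A ` range (P i) = range (P (\<sigma> i))"
    by (rule cone_aut_permutes[OF K irr A(1)], assumption, rule that)
  have AP: "A (P j z) = P (\<sigma> j) (A z)" if j: "j \<in> I" for j z
  proof -
    have "P (\<sigma> j) (A z) = P (\<sigma> j) (A (\<Sum>k\<in>I. P k z))" using sum_P by simp
    also have "\<dots> = (\<Sum>k\<in>I. P (\<sigma> j) (A (P k z)))"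
      by (simp add: linear_sum[OF lA] linear_sum[OF lP[OF \<sigma>(2)[OF j]]])
    also have "\<dots> = (\<Sum>k\<in>I. if k = j then A (P j z) else 0)"
    proof (rule sum.cong[OF refl])
      fix k assume k: "k \<in> I"
      have Ak: "A (P k z) \<in> range (P (\<sigma> k))" using \<sigma>(3)[OF k] by blast
      show "P (\<sigma> j) (A (P k z)) = (if k = j then A (P j z) else 0)"
      proof (cases "k = j")
        case True
        then show ?thesis using block_fixed[OF \<sigma>(2)[OF k] Ak] by simp
      next
        case False
        then have "\<sigma> j \<noteq> \<sigma> k" using \<sigma>(1) by (auto dest: injD)
        then show ?thesis using block_disjoint[OF \<sigma>(2)[OF j] \<sigma>(2)[OF k] _ Ak] False by simp
      qed
    qed
    also have "\<dots> = A (P j z)" using fin j by simp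
    finally show ?thesis by simp
  qed
  have orbit: "(\<sigma> ^^ l) i \<in> I" for l by (induction l) (simp_all add: i \<sigma>(2))
  have "{j. \<exists>l. j = (\<sigma> ^^ l) i} \<subseteq> I" using orbit by blast
  then have "finite {j. \<exists>l. j = (\<sigma> ^^ l) i}" using fin finite_subset by blast
  then obtain n0 where n0: "n0 > 0" "(\<sigma> ^^ n0) i = i"
    by (rule funpow_inj_finite[OF \<sigma>(1)])
  define n where "n = (LEAST n. n > 0 \<and> (\<sigma> ^^ n) i = i)"
  have n: "n > 0" "(\<sigma> ^^ n) i = i"
    unfolding n_def using LeastI[of "\<lambda>n. n > 0 \<and> (\<sigma> ^^ n) i = i"] n0 by blast+
  have before: "(\<sigma> ^^ l) i \<noteq> i" if "0 < l" "l < n" for l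
    using not_less_Least[of l "\<lambda>n. n > 0 \<and> (\<sigma> ^^ n) i = i"] that unfolding n_def by blast
  have "Suc l \<le> n \<Longrightarrow> (A ^^ Suc l) x = P ((\<sigma> ^^ Suc l) i) y'" for l
  proof (induction l)
    case 0
    have "A x = P (\<sigma> i) y'" using AP[OF i, of x'] Pi A(2) by simp
    then show ?case by simp
  next
    case (Suc l)
    let ?j = "(\<sigma> ^^ Suc l) i"
    have "(A ^^ Suc (Suc l)) x = A (P ?j y')" using Suc by simp
    also have "P ?j y' = P ?j x'" using Pj[OF orbit before[of "Suc l"]] Suc.prems by simp
    also have "A (P ?j x') = P (\<sigma> ?j) y'" using AP[OF orbit, of "Suc l" x'] A(2) by simp
    finally show ?case by simp
  qed
  from this[of "n - 1"] have "(A ^^ n) x = y" using n Pi(2) by simp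
  moreover have "A ^^ n \<in> cone_aut (range (P i)) (P i ` K)"
  proof -
    have lin: "linear (A ^^ l)" for l
    proof (induction l)
      case 0
      then show ?case using linear_id by (simp add: id_def)
    next
      case (Suc l)
      show ?case unfolding funpow.simps by (rule linear_compose[OF Suc lA])
    qed
    have inj: "inj (A ^^ l)" for l by (rule inj_fn[OF injA])
    have "(A ^^ l) ` range (P i) = range (P ((\<sigma> ^^ l) i))" for l
    proof (induction l)
      case 0
      then show ?case by simp
    next
      case (Suc l)
      have "(A ^^ Suc l) ` range (P i) = A ` ((A ^^ l) ` range (P i))" by (simp add: image_comp)
      then show ?case using Suc \<sigma>(3)[OF orbit] by simp
    qed
    from this[of n] have V: "(A ^^ n) ` range (P i) = range (P i)" using n(2) by simp
    have AlK: "(A ^^ l) ` K = K" for l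
    proof (induction l)
      case 0
      then show ?case by simp
    next
      case (Suc l)
      have "(A ^^ Suc l) ` K = A ` ((A ^^ l) ` K)" by (simp add: image_comp)
      then show ?case using Suc AK by simp
    qed
    have "(A ^^ n) ` (P i ` K) = P i ` K"
      unfolding splits_image[OF split[OF i]] image_Int[OF inj] V AlK ..
    then show ?thesis
      using lin V inj_on_subset[OF inj subset_UNIV] by (simp add: cone_aut_def bij_betw_def)
  qed
  ultimately show ?thesis by blast
qed

lemma symmetric_block:
  assumes sym: "symmetric_cone UNIV K"
    and irr: "\<And>i. i \<in> I \<Longrightarrow> irreducible_cone (range (P i)) (P i ` K)" and i: "i \<in> I"
  shows "symmetric_cone (range (P i)) (P i ` K)"
proof -
  from sym have K: "regular_cone UNIV K"
    and hom: "\<And>x y. x \<in> interior K \<Longrightarrow> y \<in> interior K \<Longrightarrow> \<exists>A\<in>cone_aut UNIV K. A x = y"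
    and B: "\<exists>B. inner_product_on UNIV B \<and> dual_cone UNIV B K = K"
    by (auto simp: symmetric_cone_def int_in_UNIV)
  then have Kp: "convex K" "cone K" "interior K \<noteq> {}"
    by (auto simp: regular_cone_def int_in_UNIV)
  have "\<exists>B. inner_product_on (range (P i)) B \<and> dual_cone (range (P i)) B (P i ` K) = P i ` K"
    using B self_dual_block[OF K split[OF i]] by blast
  then show ?thesis
    unfolding symmetric_cone_def int_in_range[OF Kp split[OF i]]
    using regular_cone_block[OF K split[OF i]] homogeneous_block[OF K irr hom i] by blast
qed

end

lemma self_scaled_imp_scaled_barrier:
  assumes "regular_cone UNIV K" "self_scaled_barrier UNIV K F"
  obtains \<nu> where "\<nu> > 0" "scaled_barrier K F \<nu>"
proof -
  from assms(2) obtain \<nu> where "\<nu> > 0" and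
    "\<forall>x\<in>interior K. \<forall>t>0. F (t *\<^sub>R x) = F x - \<nu> * ln t"
    "\<forall>x\<in>interior K. \<forall>w\<in>interior K.
       hessian UNIV (interior K) F w x \<in> interior (dual_cone UNIV (\<bullet>) K) \<and>
       conjugate_barrier UNIV K F (hessian UNIV (interior K) F w x) = ereal (F x - 2 * F w - \<nu>)"
    "self_concordant_barrier UNIV K F"
    unfolding self_scaled_barrier_def int_in_UNIV Let_def by blast
  then show ?thesis using assms(1) by (intro that[of \<nu>] scaled_barrier.intro) blast+
qed

theorem theorem4p4:
  fixes K :: "'a::euclidean_space set" and E Ks :: "nat \<Rightarrow> 'a set" and m :: nat
  assumes "symmetric_cone UNIV K"
    and "irreducible_decomposition UNIV K m E Ks"
  shows "(\<forall>i\<in>{1..m}. symmetric_cone (E i) (Ks i)) \<and>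
    (\<forall>F. self_scaled_barrier UNIV K F \<longrightarrow>
       (\<exists>Fs. barrier_decomposition UNIV K m E Ks F Fs) \<and>
       (\<forall>Fs Gs. barrier_decomposition UNIV K m E Ks F Fs \<and>
                barrier_decomposition UNIV K m E Ks F Gs \<longrightarrow>
          (\<forall>i\<in>{1..m}. \<exists>c. \<forall>x\<in>int_in (E i) (Ks i). Gs i x = Fs i x + c)))"
proof -
  let ?I = "{1..m}"
  have reg: "regular_cone UNIV K" using assms(1) by (simp add: symmetric_cone_def)
  then have Kp: "convex K" "cone K" "interior K \<noteq> {}" by (auto simp: regular_cone_def int_in_UNIV)
  have dec: "cone_decomposition UNIV K m E Ks"
    and irr: "\<And>i. i \<in> ?I \<Longrightarrow> irreducible_cone (E i) (Ks i)"
    using assms(2) by (auto simp: irreducible_decomposition_def)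
  obtain P where comp: "cone_components K ?I P"
    and E: "\<And>i. i \<in> ?I \<Longrightarrow> range (P i) = E i" and Ks: "\<And>i. i \<in> ?I \<Longrightarrow> P i ` K = Ks i"
    by (rule cone_decomposition_components[OF Kp dec], rule that)
  interpret cone_components K ?I P by (rule comp)
  have int_Ks: "int_in (E i) (Ks i) = P i ` interior K" if "i \<in> ?I" for i
    using int_in_range[OF Kp split[OF that]] E[OF that] Ks[OF that] by simp
  have lP: "linear (P i)" if "i \<in> ?I" for i using split[OF that] by (simp add: splits_def)
  have P_sum: "P j (\<Sum>i\<in>?I. x i) = x j"
    if x: "\<And>i. i \<in> ?I \<Longrightarrow> x i \<in> P i ` interior K" and j: "j \<in> ?I" for x j
  proof -
    have "P j (\<Sum>i\<in>?I. x i) = (\<Sum>i\<in>?I. P j (x i))" by (rule linear_sum[OF lP[OF j]])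
    also have "\<dots> = (\<Sum>i\<in>?I. if i = j then x i else 0)"
    proof (rule sum.cong[OF refl])
      fix i assume i: "i \<in> ?I"
      then have xi: "x i \<in> range (P i)" using x by blast
      show "P j (x i) = (if i = j then x i else 0)"
        using block_fixed[OF i xi] block_disjoint[OF j i _ xi] by (cases "i = j") simp_all
    qed
    also have "\<dots> = x j" using j by simp
    finally show ?thesis .
  qed
  have "symmetric_cone (E i) (Ks i)" if "i \<in> ?I" for i
    using symmetric_block[OF assms(1) _ that] irr E Ks that by simp
  moreover have "\<exists>Fs. barrier_decomposition UNIV K m E Ks F Fs"
    if F: "self_scaled_barrier UNIV K F" for F
  proof -
    obtain \<nu> where \<nu>: "\<nu> > 0" "scaled_barrier K F \<nu>"
      by (rule self_scaled_imp_scaled_barrier[OF reg F], rule that)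
    interpret scaled_barrier K F \<nu> by (rule \<nu>(2))
    obtain e0 where e0: "e0 \<in> interior K" using Kp(3) by blast
    \<comment> \<open>scaling by \<open>t\<close> lowers \<open>F\<close> by \<open>\<nu> * ln t\<close>, so this multiple of \<open>e0\<close> is a zero of \<open>F\<close>\<close>
    define e where "e = exp (F e0 / \<nu>) *\<^sub>R e0"
    have e: "e \<in> interior K" and Fe: "F e = 0"
      unfolding e_def using scale_U[OF e0] log_homogeneous[OF e0] \<nu>(1) by simp_all
    have "F (\<Sum>i\<in>?I. x i) = (\<Sum>i\<in>?I. F (x i + (e - P i e)))"
      if x: "\<And>i. i \<in> ?I \<Longrightarrow> x i \<in> P i ` interior K" and s: "(\<Sum>i\<in>?I. x i) \<in> interior K" for x
    proof -
      have "F (\<Sum>i\<in>?I. x i) = (\<Sum>i\<in>?I. F (P i (\<Sum>i\<in>?I. x i) + (e - P i e)))"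
        using F_sum_blocks[where P = P, OF split fin disjoint s e Fe] by (simp add: sum_P)
      then show ?thesis using P_sum[OF x] by simp
    qed
    then have "barrier_decomposition UNIV K m E Ks F (\<lambda>i y. F (y + (e - P i e)))"
      unfolding barrier_decomposition_def int_in_UNIV
      using self_scaled_block[OF split nonzero e] E Ks int_Ks by simp
    then show ?thesis by blast
  qed
  moreover have "\<exists>c. \<forall>x\<in>int_in (E i) (Ks i). Gs i x = Fs i x + c"
    if Fs: "barrier_decomposition UNIV K m E Ks F Fs"
      and Gs: "barrier_decomposition UNIV K m E Ks F Gs" and i: "i \<in> ?I" for F Fs Gs i
  proof -
    obtain e where e: "e \<in> interior K" using Kp(3) by blast
    have sum_F: "F x = (\<Sum>j\<in>?I. Hs j (P j x))"
      if "barrier_decomposition UNIV K m E Ks F Hs" "x \<in> interior K" for x Hs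
    proof -
      have "F (\<Sum>j\<in>?I. P j x) = (\<Sum>j\<in>?I. Hs j (P j x))"
        using that sum_P int_Ks unfolding barrier_decomposition_def int_in_UNIV
        by (elim conjE allE[of _ "\<lambda>j. P j x"]) simp
      then show ?thesis by (simp add: sum_P)
    qed
    \<comment> \<open>freezing the other coordinates at \<open>e\<close> determines the \<open>i\<close>th summand up to what the others contribute\<close>
    let ?rest = "\<lambda>Hs. \<Sum>j\<in>?I - {i}. Hs j (P j e) :: real"
    have "Hs i x + ?rest Hs = F (x + (e - P i e))"
      if Hs: "barrier_decomposition UNIV K m E Ks F Hs" and x: "x \<in> P i ` interior K" for Hs x
    proof -
      let ?z = "x + (e - P i e)"
      have z: "?z \<in> interior K" using x interior_exchange[OF Kp(1,2) split[OF i] _ e] by auto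
      have Pi: "P i ?z = x"
        using x by (intro block_shift(1)[OF i]) blast
      have "P j ?z = P j e" if "j \<in> ?I - {i}" for j
        using that x by (intro block_shift(2)[OF i]) blast+
      then have "F ?z = Hs i x + ?rest Hs"
        unfolding sum_F[OF Hs z] using i Pi by (simp add: sum.remove[of ?I i])
      then show ?thesis by simp
    qed
    from this[OF Fs] this[OF Gs]
    have "Gs i x = Fs i x + (?rest Fs - ?rest Gs)" if "x \<in> int_in (E i) (Ks i)" for x
      using that int_Ks[OF i] by (simp add: algebra_simps)
    then show ?thesis by blast
  qed
  ultimately show ?thesis by blast
qed

end
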